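(* Let $X$ be a Banach space and let $\mathcal{U}=\{U(t,s)\}_{t\ge s\ge 0}$ be a nonuniform exponentially bounded evolution family on $X$. Then $\mathcal{U}$ is nonuniform exponentially stable if and only if there exists $\alpha\in\mathcal{A}(\mathcal{U})$ such that the generator $G_{\mathcal{U},\alpha}$ is invertible. In particular, if $\mathcal{U}$ is uniform exponentially bounded, then $\mathcal{U}$ is uniform exponentially stable if and only if the generator $G$ of the evolution semigroup $\mathcal{T}$ on $C_{00}(\mathbb{R}_+,X)$ is invertible.
   Context: $\mathbb{R}_+=[0,\infty)$; $C(\mathbb{R}_+,X)$ is the space of all continuous functions $\mathbb{R}_+\to X$; $C_{00}(\mathbb{R}_+,X)=\{u\in C(\mathbb{R}_+,X):\lim_{t\to\infty}u(t)=u(0)=0\}$ with the sup norm. An evolution family (on the half-line) is a family $\mathcal{U}=\{U(t,s)\}_{t\ge s\ge 0}$ of bounded linear operators on $X$ such that $U(t,t)=\mathrm{Id}$ for $t\ge 0$; $U(t,\tau)U(\tau,s)=U(t,s)$ for $t\ge\tau\ge s\ge 0$; and $(t,s)\mapsto U(t,s)x$ is continuous on $\{t\ge s\ge 0\}$ for every $x\in X$. A number $\alpha\in\mathbb{R}$ is an admissible exponent of $\mathcal{U}$ if there is a continuous map $M_\alpha:\mathbb{R}_+\to(0,\infty)$ with $\|U(t,s)\|\le M_\alpha(s)e^{\alpha(t-s)}$ for all $t\ge s\ge 0$. $\mathcal{A}(\mathcal{U})$ is the set of all admissible exponents. $\mathcal{U}$ is nonuniform exponentially bounded if $\mathcal{A}(\mathcal{U})\ne\emptyset$,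 and nonuniform exponentially stable if $\mathcal{A}(\mathcal{U})$ contains a negative number. If $M_\alpha$ can be chosen bounded (equivalently, constant), $\alpha$ is called a strict exponent; $\mathcal{U}$ is uniform exponentially bounded if it has a strict exponent, and uniform exponentially stable if it has a negative strict exponent. For $\alpha\in\mathcal{A}(\mathcal{U})$, $t\ge 0$ and $u\in C(\mathbb{R}_+,X)$, put $\varphi_{\mathcal{U},\alpha}(t,u)=\sup_{\tau\ge t}e^{-\alpha(\tau-t)}\|U(\tau,t)u(t)\|$. The admissible Banach function space is $$\mathcal{C}(\mathcal{U},\alpha)=\{u\in C(\mathbb{R}_+,X):\ \lim_{t\to\infty}\varphi_{\mathcal{U},\alpha}(t,u)=\|u(0)\|=0\},$$ which is a Banach space with the norm $\|u\|_{\mathcal{U},\alpha}=\sup_{t\ge 0}\varphi_{\mathcal{U},\alpha}(t,u)$. On it, the formula $(T_\alpha(t)u)(s)=U(s,s-t)u(s-t)$ if $s>t$, and $(T_\alpha(t)u)(s)=0$ if $0\le s\le t$, defines a $C_0$-semigroup $\mathcal{T}_\alpha=\{T_\alpha(t)\}_{t\ge 0}$; its infinitesimal generator is denoted $G_{\mathcal{U},\alpha}$. If $\mathcal{U}$ is uniform exponentially bounded, the evolution semigroup $\mathcal{T}=\{T(t)\}_{t\ge 0}$ on $C_{00}(\mathbb{R}_+,X)$ is the $C_0$-semigroup given by $(T(t)u)(s)=U(s,s-t)u(s-t)$ if $s>t$, and $(T(t)u)(s)=U(s,0)u(0)$ $(=0)$ if $0\le s\le t$. The generator of a $C_0$-semigroup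 $\{T(t)\}$ on a Banach space $E$ is the operator $Gx=\lim_{t\to 0_+}\frac{T(t)x-x}{t}$ whose domain $D(G)$ consists of the $x\in E$ for which the limit exists. A linear operator $G:D(G)\subset E\to E$ is called invertible if it is a bijection from $D(G)$ onto $E$ with bounded inverse. *)

theory Defs
  imports "HOL-Analysis.Analysis"
begin

section \<open>Evolution families on the half-line\<close>

text \<open>
  A family is a total function \<open>U\<close> of two reals; only the values \<open>U t s\<close> with
  \<open>0 \<le> s \<le> t\<close> are ever constrained or used.  The norm of \<open>U t s\<close> is the operator norm.
\<close>

definition evolution_family :: "(real \<Rightarrow> real \<Rightarrow> 'a::banach \<Rightarrow>\<^sub>L 'a) \<Rightarrow> bool" where
  "evolution_family U \<longleftrightarrow>
     (\<forall>t\<ge>0. U t t = id_blinfun) \<and>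
     (\<forall>t r s. 0 \<le> s \<and> s \<le> r \<and> r \<le> t \<longrightarrow> U t r o\<^sub>L U r s = U t s) \<and>
     (\<forall>x. continuous_on {(t, s). 0 \<le> s \<and> s \<le> t} (\<lambda>(t, s). blinfun_apply (U t s) x))"

definition exponent_bound ::
    "(real \<Rightarrow> real \<Rightarrow> 'a::banach \<Rightarrow>\<^sub>L 'a) \<Rightarrow> real \<Rightarrow> (real \<Rightarrow> real) \<Rightarrow> bool" where
  "exponent_bound U \<alpha> M \<longleftrightarrow>
     continuous_on {0..} M \<and> (\<forall>s\<ge>0. 0 < M s) \<and>
     (\<forall>t s. 0 \<le> s \<and> s \<le> t \<longrightarrow> norm (U t s) \<le> M s * exp (\<alpha> * (t - s)))"

definition admissible_exponents :: "(real \<Rightarrow> real \<Rightarrow> 'a::banach \<Rightarrow>\<^sub>L 'a) \<Rightarrow> real set" where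
  "admissible_exponents U = {\<alpha>. \<exists>M. exponent_bound U \<alpha> M}"

definition strict_exponents :: "(real \<Rightarrow> real \<Rightarrow> 'a::banach \<Rightarrow>\<^sub>L 'a) \<Rightarrow> real set" where
  "strict_exponents U = {\<alpha>. \<exists>M. exponent_bound U \<alpha> M \<and> bounded (M ` {0..})}"

definition nonuniform_exp_bounded :: "(real \<Rightarrow> real \<Rightarrow> 'a::banach \<Rightarrow>\<^sub>L 'a) \<Rightarrow> bool" where
  "nonuniform_exp_bounded U \<longleftrightarrow> admissible_exponents U \<noteq> {}"

definition nonuniform_exp_stable :: "(real \<Rightarrow> real \<Rightarrow> 'a::banach \<Rightarrow>\<^sub>L 'a) \<Rightarrow> bool" where
  "nonuniform_exp_stable U \<longleftrightarrow> (\<exists>\<alpha>\<in>admissible_exponents U. \<alpha> < 0)"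

definition uniform_exp_bounded :: "(real \<Rightarrow> real \<Rightarrow> 'a::banach \<Rightarrow>\<^sub>L 'a) \<Rightarrow> bool" where
  "uniform_exp_bounded U \<longleftrightarrow> strict_exponents U \<noteq> {}"

definition uniform_exp_stable :: "(real \<Rightarrow> real \<Rightarrow> 'a::banach \<Rightarrow>\<^sub>L 'a) \<Rightarrow> bool" where
  "uniform_exp_stable U \<longleftrightarrow> (\<exists>\<alpha>\<in>strict_exponents U. \<alpha> < 0)"


section \<open>Function spaces on the half-line\<close>

text \<open>
  A function on the half-line is represented by its extension by zero to the whole real line,
  so that equality of elements is equality of functions and the spaces below are closed under
  the pointwise vector operations.
\<close>

definition C_space :: "(real \<Rightarrow> 'a::banach) set" where
  "C_space = {u. continuous_on {0..} u \<and> (\<forall>t<0. u t = 0)}"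

definition C00_space :: "(real \<Rightarrow> 'a::banach) set" where
  "C00_space = {u \<in> C_space. (u \<longlongrightarrow> 0) at_top \<and> u 0 = 0}"

definition C00_norm :: "(real \<Rightarrow> 'a::banach) \<Rightarrow> real" where
  "C00_norm u = (SUP t\<in>{0..}. norm (u t))"

text \<open>
  The suprema below are real-valued.  For an admissible \<open>\<alpha>\<close>, with bound \<open>M\<close>, the first one is over
  a set bounded by \<open>M t * norm (u t)\<close>; hence, on \<open>adm_space U \<alpha>\<close>, the second one is finite as well
  (\<open>adm_phi\<close> is locally bounded and tends to zero).
\<close>

definition adm_phi ::
    "(real \<Rightarrow> real \<Rightarrow> 'a::banach \<Rightarrow>\<^sub>L 'a) \<Rightarrow> real \<Rightarrow> real \<Rightarrow> (real \<Rightarrow> 'a) \<Rightarrow> real" where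
  "adm_phi U \<alpha> t u = (SUP \<tau>\<in>{t..}. exp (- \<alpha> * (\<tau> - t)) * norm (blinfun_apply (U \<tau> t) (u t)))"

definition adm_space ::
    "(real \<Rightarrow> real \<Rightarrow> 'a::banach \<Rightarrow>\<^sub>L 'a) \<Rightarrow> real \<Rightarrow> (real \<Rightarrow> 'a) set" where
  "adm_space U \<alpha> = {u \<in> C_space. ((\<lambda>t. adm_phi U \<alpha> t u) \<longlongrightarrow> 0) at_top \<and> norm (u 0) = 0}"

definition adm_norm ::
    "(real \<Rightarrow> real \<Rightarrow> 'a::banach \<Rightarrow>\<^sub>L 'a) \<Rightarrow> real \<Rightarrow> (real \<Rightarrow> 'a) \<Rightarrow> real" where
  "adm_norm U \<alpha> u = (SUP t\<in>{0..}. adm_phi U \<alpha> t u)"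


section \<open>Evolution semigroups\<close>

text \<open>
  The formula for the semigroup on \<open>adm_space U \<alpha>\<close> does not involve \<open>\<alpha>\<close>; the exponent enters its
  generator through the space and the norm.
\<close>

definition adm_semigroup ::
    "(real \<Rightarrow> real \<Rightarrow> 'a::banach \<Rightarrow>\<^sub>L 'a) \<Rightarrow> real \<Rightarrow> (real \<Rightarrow> 'a) \<Rightarrow> (real \<Rightarrow> 'a)" where
  "adm_semigroup U t u = (\<lambda>s. if t < s then blinfun_apply (U s (s - t)) (u (s - t)) else 0)"

definition evolution_semigroup ::
    "(real \<Rightarrow> real \<Rightarrow> 'a::banach \<Rightarrow>\<^sub>L 'a) \<Rightarrow> real \<Rightarrow> (real \<Rightarrow> 'a) \<Rightarrow> (real \<Rightarrow> 'a)" where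
  "evolution_semigroup U t u =
     (\<lambda>s. if t < s then blinfun_apply (U s (s - t)) (u (s - t))
          else if 0 \<le> s then blinfun_apply (U s 0) (u 0) else 0)"


section \<open>Generators and invertibility\<close>

text \<open>
  Here \<open>E\<close> is a space of functions with norm \<open>N\<close>, and \<open>T\<close> a semigroup on it; limits are taken in
  the norm \<open>N\<close>, which makes the value chosen by \<open>THE\<close> unique on the domain.
\<close>

definition generator_limit ::
    "(real \<Rightarrow> 'a::banach) set \<Rightarrow> ((real \<Rightarrow> 'a) \<Rightarrow> real) \<Rightarrow>
     (real \<Rightarrow> (real \<Rightarrow> 'a) \<Rightarrow> (real \<Rightarrow> 'a)) \<Rightarrow> (real \<Rightarrow> 'a) \<Rightarrow> (real \<Rightarrow> 'a) \<Rightarrow> bool" where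
  "generator_limit E N T x y \<longleftrightarrow>
     y \<in> E \<and> ((\<lambda>h. N (\<lambda>s. (T h x s - x s) /\<^sub>R h - y s)) \<longlongrightarrow> 0) (at_right 0)"

definition generator_domain ::
    "(real \<Rightarrow> 'a::banach) set \<Rightarrow> ((real \<Rightarrow> 'a) \<Rightarrow> real) \<Rightarrow>
     (real \<Rightarrow> (real \<Rightarrow> 'a) \<Rightarrow> (real \<Rightarrow> 'a)) \<Rightarrow> (real \<Rightarrow> 'a) set" where
  "generator_domain E N T = {x \<in> E. \<exists>y. generator_limit E N T x y}"

definition generator ::
    "(real \<Rightarrow> 'a::banach) set \<Rightarrow> ((real \<Rightarrow> 'a) \<Rightarrow> real) \<Rightarrow>
     (real \<Rightarrow> (real \<Rightarrow> 'a) \<Rightarrow> (real \<Rightarrow> 'a)) \<Rightarrow> (real \<Rightarrow> 'a) \<Rightarrow> (real \<Rightarrow> 'a)" where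
  "generator E N T x = (THE y. generator_limit E N T x y)"

definition invertible_operator ::
    "(real \<Rightarrow> 'a::banach) set \<Rightarrow> ((real \<Rightarrow> 'a) \<Rightarrow> real) \<Rightarrow>
     (real \<Rightarrow> 'a) set \<Rightarrow> ((real \<Rightarrow> 'a) \<Rightarrow> (real \<Rightarrow> 'a)) \<Rightarrow> bool" where
  "invertible_operator E N D G \<longleftrightarrow>
     bij_betw G D E \<and> (\<exists>K. \<forall>y\<in>E. N (inv_into D G y) \<le> K * N y)"

definition adm_generator_domain ::
    "(real \<Rightarrow> real \<Rightarrow> 'a::banach \<Rightarrow>\<^sub>L 'a) \<Rightarrow> real \<Rightarrow> (real \<Rightarrow> 'a) set" where
  "adm_generator_domain U \<alpha> = generator_domain (adm_space U \<alpha>) (adm_norm U \<alpha>) (adm_semigroup U)"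

definition adm_generator ::
    "(real \<Rightarrow> real \<Rightarrow> 'a::banach \<Rightarrow>\<^sub>L 'a) \<Rightarrow> real \<Rightarrow> (real \<Rightarrow> 'a) \<Rightarrow> (real \<Rightarrow> 'a)" where
  "adm_generator U \<alpha> = generator (adm_space U \<alpha>) (adm_norm U \<alpha>) (adm_semigroup U)"

definition evolution_generator_domain ::
    "(real \<Rightarrow> real \<Rightarrow> 'a::banach \<Rightarrow>\<^sub>L 'a) \<Rightarrow> (real \<Rightarrow> 'a) set" where
  "evolution_generator_domain U = generator_domain C00_space C00_norm (evolution_semigroup U)"

definition evolution_generator ::
    "(real \<Rightarrow> real \<Rightarrow> 'a::banach \<Rightarrow>\<^sub>L 'a) \<Rightarrow> (real \<Rightarrow> 'a) \<Rightarrow> (real \<Rightarrow> 'a)" where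
  "evolution_generator U = generator C00_space C00_norm (evolution_semigroup U)"

end

theory Submission
  imports Defs "HOL-Real_Asymp.Real_Asymp"
begin

text \<open>
  An admissible exponent \<open>\<alpha>\<close> is turned into a uniform one by changing the norm with time.  Put
  \<open>|x|\<^sub>t = sup {exp (- \<alpha> (\<tau> - t)) \<parallel>U \<tau> t x\<parallel> | \<tau> \<ge> t}\<close>.  Then
  \<open>\<parallel>x\<parallel> \<le> |x|\<^sub>t \<le> M t \<parallel>x\<parallel>\<close> and \<open>|U t s x|\<^sub>t \<le> exp (\<alpha> (t - s)) |x|\<^sub>s\<close>, with constant one and without any
  trace of the nonuniformity, and the norm of the admissible function space is
  \<open>sup {|u t|\<^sub>t | t \<ge> 0}\<close>.  So the classical argument for uniformly bounded families can be run
  in these norms, and the factor \<open>M\<close> enters only when the original norm is restored at the end.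

  The bridge between the generator \<open>G\<close> and the family is variation of constants: \<open>G u = v\<close> holds if and
  only if \<open>u t = - \<integral> U t r (v r) dr\<close>, integrated over \<open>0 \<le> r \<le> t\<close> (\<open>generator_limit_mild\<close> and
  \<open>mild_generator_limit\<close>).  Inverting \<open>G\<close> therefore means that this integral operator acts boundedly
  on the function space.

  If \<open>\<alpha> < 0\<close>, the integral operator is a convolution with a kernel of norm at most
  \<open>exp (\<alpha> (t - r))\<close>, hence bounded by \<open>1 / |\<alpha>|\<close> (\<open>negative_exponent_invertible\<close>).

  Conversely, let the integral operator be bounded by \<open>K\<close>.  Feed it with \<open>v r = \<eta> r U r s x\<close>, where
  \<open>\<eta>\<close> is a cutoff supported in \<open>[s, s + T]\<close>.  The integrand \<open>U t r (v r) = \<eta> r U t s x\<close> is a multiple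
  of a fixed vector, so the integral is \<open>(\<integral> \<eta>) U t s x\<close>, while \<open>v\<close> is controlled by the size of the
  orbit on \<open>[s, s + T]\<close> alone.  For \<open>T = 3\<close> this shows that all orbits stay bounded; for large \<open>T\<close>, the
  factor \<open>\<integral> \<eta> \<ge> T - 2\<close> then forces them to be halved over time \<open>T\<close>.  Iteration gives exponential
  decay with a bound that is a constant times \<open>M\<close> (\<open>invertible_exponential_decay\<close>).

  Because the new bound is proportional to \<open>M\<close>, strictness of the exponent is preserved.  When \<open>M\<close> is
  bounded, all the norms \<open>|x|\<^sub>t\<close> are uniformly equivalent to the original one, the admissible space is
  \<open>C00_space\<close> with an equivalent norm, and the two generators coincide (\<open>invertible_C00_iff\<close>).  The
  uniform statement is thus a special case of the nonuniform one.
\<close>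


section \<open>A fundamental theorem for one-sided derivatives\<close>

text \<open>
  A semigroup of right shifts only ever compares a value with values to its left, so it yields left
  difference quotients.  Since they converge uniformly to a continuous limit, the quotient to the
  right of \<open>x\<close>, which is the left quotient at \<open>y > x\<close>, is close to \<open>f y\<close> and therefore to
  \<open>f x\<close>: the derivative is two-sided.
\<close>

lemma has_integral_uniform_left_derivative:
  fixes g f :: "real \<Rightarrow> 'a::banach"
  assumes "a \<le> b" and cf: "continuous_on {a..b} f"
    and left: "\<And>e. 0 < e \<Longrightarrow> \<exists>d>0. \<forall>h r. 0 < h \<and> h < d \<and> a \<le> r - h \<and> r \<le> b \<longrightarrow>
                 norm (g r - g (r - h) - h *\<^sub>R f r) \<le> e * h"
  shows "(f has_integral (g b - g a)) {a..b}"
proof (rule fundamental_theorem_of_calculus[OF \<open>a \<le> b\<close>])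
  fix x assume x: "x \<in> {a..b}"
  show "(g has_vector_derivative f x) (at x within {a..b})"
    unfolding has_vector_derivative_def has_derivative_within_alt
  proof (intro conjI allI impI)
    show "bounded_linear (\<lambda>h. h *\<^sub>R f x)" by (rule bounded_linear_scaleR_left)
    fix e :: real assume "0 < e"
    then obtain d where d: "d > 0"
      and dg: "\<And>h r. 0 < h \<Longrightarrow> h < d \<Longrightarrow> a \<le> r - h \<Longrightarrow> r \<le> b \<Longrightarrow>
                 norm (g r - g (r - h) - h *\<^sub>R f r) \<le> e / 2 * h"
      using left[of "e / 2"] by auto
    obtain d' where d': "d' > 0" and df: "\<And>y. y \<in> {a..b} \<Longrightarrow> dist y x < d' \<Longrightarrow> dist (f y) (f x) < e / 2"
      using cf x \<open>0 < e\<close> unfolding continuous_on_iff by (metis half_gt_zero)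
    show "\<exists>d>0. \<forall>y\<in>{a..b}. norm (y - x) < d \<longrightarrow>
            norm (g y - g x - (y - x) *\<^sub>R f x) \<le> e * norm (y - x)"
    proof (intro exI conjI ballI impI)
      show "min d d' > 0" using d d' by simp
      fix y assume y: "y \<in> {a..b}" and yx: "norm (y - x) < min d d'"
      consider "y = x" | "y < x" | "x < y" by linarith
      then show "norm (g y - g x - (y - x) *\<^sub>R f x) \<le> e * norm (y - x)"
      proof cases
        case 1 then show ?thesis by simp
      next
        case 2
        have "norm (g x - g (x - (x - y)) - (x - y) *\<^sub>R f x) \<le> e / 2 * (x - y)"
          using 2 x y yx by (intro dg) auto
        also have "g x - g (x - (x - y)) - (x - y) *\<^sub>R f x = - (g y - g x - (y - x) *\<^sub>R f x)"
          by (simp add: algebra_simps)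
        finally have "norm (g y - g x - (y - x) *\<^sub>R f x) \<le> e / 2 * (x - y)"
          by (simp only: norm_minus_cancel)
        also have "\<dots> \<le> e * norm (y - x)" using 2 \<open>0 < e\<close> by simp
        finally show ?thesis .
      next
        case 3
        \<comment> \<open>the left quotient at \<open>y\<close> serves as right quotient at \<open>x\<close>\<close>
        have "norm (g y - g (y - (y - x)) - (y - x) *\<^sub>R f y) \<le> e / 2 * (y - x)"
          using 3 x y yx by (intro dg) auto
        then have 1: "norm (g y - g x - (y - x) *\<^sub>R f y) \<le> e / 2 * (y - x)" by simp
        have "norm (f y - f x) \<le> e / 2"
          using df[OF y] yx by (simp add: dist_norm)
        then have 2: "norm ((y - x) *\<^sub>R (f y - f x)) \<le> e / 2 * (y - x)"
          using 3 by (simp add: mult.commute mult_left_mono)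
        have "g y - g x - (y - x) *\<^sub>R f x = (g y - g x - (y - x) *\<^sub>R f y) + (y - x) *\<^sub>R (f y - f x)"
          by (simp add: algebra_simps)
        then have "norm (g y - g x - (y - x) *\<^sub>R f x) \<le> e / 2 * (y - x) + e / 2 * (y - x)"
          using norm_triangle_mono[OF 1 2] by (simp only:)
        also have "\<dots> = e * norm (y - x)" using 3 by simp
        finally show ?thesis .
      qed
    qed
  qed
qed


section \<open>Lyapunov norms\<close>

locale bounded_evolution =
  fixes U :: "real \<Rightarrow> real \<Rightarrow> 'a::banach \<Rightarrow>\<^sub>L 'a" and \<alpha> :: real and M :: "real \<Rightarrow> real"
  assumes family: "evolution_family U" and bound: "exponent_bound U \<alpha> M"
begin

lemma U_refl [simp]: "0 \<le> t \<Longrightarrow> blinfun_apply (U t t) x = x"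
  using family by (simp add: evolution_family_def)

lemma U_comp:
  assumes "0 \<le> s" "s \<le> r" "r \<le> t"
  shows "blinfun_apply (U t r) (blinfun_apply (U r s) x) = blinfun_apply (U t s) x"
proof -
  have "U t r o\<^sub>L U r s = U t s"
    using family assms unfolding evolution_family_def by blast
  then show ?thesis using blinfun_apply_blinfun_compose[of "U t r" "U r s" x] by simp
qed

lemma U_continuous: "continuous_on {(t, s). 0 \<le> s \<and> s \<le> t} (\<lambda>(t, s). blinfun_apply (U t s) x)"
  using family by (simp add: evolution_family_def)

lemma M_pos: "0 \<le> s \<Longrightarrow> 0 < M s"
  and M_continuous: "continuous_on {0..} M"
  and U_bound: "0 \<le> s \<Longrightarrow> s \<le> t \<Longrightarrow> norm (U t s) \<le> M s * exp (\<alpha> * (t - s))"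
  using bound unfolding exponent_bound_def by blast+

text \<open>
  The norm \<open>|x|\<^sub>t\<close>, a Lyapunov function for the rescaled family: a supremum over the whole future of an
  orbit cannot increase along it.
\<close>

definition lyap :: "real \<Rightarrow> 'a \<Rightarrow> real" where
  "lyap t x = (SUP \<tau>\<in>{t..}. exp (- \<alpha> * (\<tau> - t)) * norm (blinfun_apply (U \<tau> t) x))"

lemma adm_phi_lyap: "adm_phi U \<alpha> t u = lyap t (u t)"
  by (simp add: adm_phi_def lyap_def)

lemma lyap_term_le:
  assumes "0 \<le> t" "t \<le> \<tau>"
  shows "exp (- \<alpha> * (\<tau> - t)) * norm (blinfun_apply (U \<tau> t) x) \<le> M t * norm x"
proof -
  have "norm (blinfun_apply (U \<tau> t) x) \<le> (M t * exp (\<alpha> * (\<tau> - t))) * norm x"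
    using norm_blinfun[of "U \<tau> t" x] mult_right_mono[OF U_bound[OF assms], of "norm x"] by simp
  then have "exp (- \<alpha> * (\<tau> - t)) * norm (blinfun_apply (U \<tau> t) x)
      \<le> exp (- \<alpha> * (\<tau> - t)) * ((M t * exp (\<alpha> * (\<tau> - t))) * norm x)"
    by simp
  also have "\<dots> = (exp (- \<alpha> * (\<tau> - t)) * exp (\<alpha> * (\<tau> - t))) * (M t * norm x)" by simp
  also have "\<dots> = M t * norm x" by (simp flip: exp_add)
  finally show ?thesis .
qed

lemma lyap_upper:
  assumes "0 \<le> t" "t \<le> \<tau>"
  shows "exp (- \<alpha> * (\<tau> - t)) * norm (blinfun_apply (U \<tau> t) x) \<le> lyap t x"
  unfolding lyap_def using assms lyap_term_le
  by (intro cSUP_upper bdd_aboveI2[where M = "M t * norm x"]) auto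

lemma lyap_least:
  assumes "\<And>\<tau>. t \<le> \<tau> \<Longrightarrow> exp (- \<alpha> * (\<tau> - t)) * norm (blinfun_apply (U \<tau> t) x) \<le> c"
  shows "lyap t x \<le> c"
  unfolding lyap_def using assms by (intro cSUP_least) auto

lemma norm_le_lyap: "0 \<le> t \<Longrightarrow> norm x \<le> lyap t x"
  using lyap_upper[of t t x] by simp

lemma lyap_le_norm: "0 \<le> t \<Longrightarrow> lyap t x \<le> M t * norm x"
  by (intro lyap_least lyap_term_le)

lemma lyap_nonneg: "0 \<le> t \<Longrightarrow> 0 \<le> lyap t x"
  using norm_le_lyap[of t x] norm_ge_zero[of x] by linarith

lemma lyap_zero [simp]: "lyap t 0 = 0"
  by (simp add: lyap_def)

lemma lyap_triangle:
  assumes "0 \<le> t"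
  shows "lyap t (x + y) \<le> lyap t x + lyap t y"
proof (rule lyap_least)
  fix \<tau> assume \<tau>: "t \<le> \<tau>"
  have "exp (- \<alpha> * (\<tau> - t)) * norm (blinfun_apply (U \<tau> t) (x + y))
      \<le> exp (- \<alpha> * (\<tau> - t)) * (norm (blinfun_apply (U \<tau> t) x) + norm (blinfun_apply (U \<tau> t) y))"
    by (simp add: blinfun.add_right norm_triangle_ineq)
  then show "exp (- \<alpha> * (\<tau> - t)) * norm (blinfun_apply (U \<tau> t) (x + y)) \<le> lyap t x + lyap t y"
    using lyap_upper[OF assms \<tau>, of x] lyap_upper[OF assms \<tau>, of y] by (simp add: distrib_left)
qed

lemma lyap_scaleR_le:
  assumes "0 \<le> t"
  shows "lyap t (c *\<^sub>R x) \<le> \<bar>c\<bar> * lyap t x"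
proof (rule lyap_least)
  fix \<tau> assume "t \<le> \<tau>"
  from mult_left_mono[OF lyap_upper[OF assms this, of x], of "\<bar>c\<bar>"]
  show "exp (- \<alpha> * (\<tau> - t)) * norm (blinfun_apply (U \<tau> t) (c *\<^sub>R x)) \<le> \<bar>c\<bar> * lyap t x"
    by (simp add: blinfun.scaleR_right mult.left_commute)
qed

lemma lyap_scaleR:
  assumes "0 \<le> t"
  shows "lyap t (c *\<^sub>R x) = \<bar>c\<bar> * lyap t x"
proof (cases "c = 0")
  case False
  have "lyap t (inverse c *\<^sub>R (c *\<^sub>R x)) \<le> \<bar>inverse c\<bar> * lyap t (c *\<^sub>R x)"
    by (rule lyap_scaleR_le[OF assms])
  then have "\<bar>c\<bar> * lyap t x \<le> \<bar>c\<bar> * (\<bar>inverse c\<bar> * lyap t (c *\<^sub>R x))"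
    using False by (intro mult_left_mono) auto
  also have "\<dots> = lyap t (c *\<^sub>R x)" using False by (simp flip: mult.assoc abs_mult)
  finally show ?thesis using lyap_scaleR_le[OF assms, of c x] by simp
qed simp

lemma lyap_minus: "0 \<le> t \<Longrightarrow> lyap t (- x) = lyap t x"
  using lyap_scaleR[of t "-1" x] by simp

lemma lyap_diff: "0 \<le> t \<Longrightarrow> lyap t (x - y) \<le> lyap t x + lyap t y"
  using lyap_triangle[of t x "- y"] lyap_minus[of t y] by simp

text \<open>
  The future of \<open>U t s x\<close> after \<open>t\<close> is part of the future of \<open>x\<close> after \<open>s\<close>; only the weight is
  shifted.  This is why no constant other than one appears.
\<close>

lemma lyap_evolution:
  assumes "0 \<le> s" "s \<le> t"
  shows "lyap t (blinfun_apply (U t s) x) \<le> exp (\<alpha> * (t - s)) * lyap s x"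
proof (rule lyap_least)
  fix \<tau> assume \<tau>: "t \<le> \<tau>"
  have "exp (- \<alpha> * (\<tau> - t)) = exp (\<alpha> * (t - s)) * exp (- \<alpha> * (\<tau> - s))"
    by (simp add: algebra_simps flip: exp_add)
  then show "exp (- \<alpha> * (\<tau> - t)) * norm (blinfun_apply (U \<tau> t) (blinfun_apply (U t s) x))
      \<le> exp (\<alpha> * (t - s)) * lyap s x"
    using lyap_upper[of s \<tau> x] assms \<tau> by (simp add: U_comp mult.assoc)
qed

lemma norm_evolution_le:
  assumes "0 \<le> s" "s \<le> t"
  shows "norm (blinfun_apply (U t s) x) \<le> exp (\<alpha> * (t - s)) * lyap s x"
  by (rule order_trans[OF norm_le_lyap lyap_evolution[OF assms]]) (use assms in simp)

text \<open>
  The supremum is estimated term by term, each term being the norm of a bounded linear image of the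
  integral.  The majorant \<open>g\<close> is a separate function so that measurability of \<open>lyap t (f r)\<close> in
  \<open>r\<close> never becomes an issue.
\<close>

lemma lyap_integral:
  assumes t: "0 \<le> t" and f: "f integrable_on S" and g: "g integrable_on S"
    and le: "\<And>r. r \<in> S \<Longrightarrow> lyap t (f r) \<le> g r"
  shows "lyap t (integral S f) \<le> integral S g"
proof (rule lyap_least)
  fix \<tau> assume \<tau>: "t \<le> \<tau>"
  have lin: "bounded_linear (\<lambda>x. exp (- \<alpha> * (\<tau> - t)) *\<^sub>R blinfun_apply (U \<tau> t) x)"
    using bounded_linear_compose[OF bounded_linear_scaleR_right[of "exp (- \<alpha> * (\<tau> - t))"]
        blinfun.bounded_linear_right[of "U \<tau> t"]] .
  have "norm (integral S ((\<lambda>x. exp (- \<alpha> * (\<tau> - t)) *\<^sub>R blinfun_apply (U \<tau> t) x) \<circ> f)) \<le> integral S g"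
  proof (rule integral_norm_bound_integral[OF integrable_linear[OF f lin] g])
    fix r assume "r \<in> S"
    then show "norm (((\<lambda>x. exp (- \<alpha> * (\<tau> - t)) *\<^sub>R blinfun_apply (U \<tau> t) x) \<circ> f) r) \<le> g r"
      using lyap_upper[OF t \<tau>, of "f r"] le[of r] by simp
  qed
  then show "exp (- \<alpha> * (\<tau> - t)) * norm (blinfun_apply (U \<tau> t) (integral S f)) \<le> integral S g"
    unfolding integral_linear[OF f lin] by simp
qed


section \<open>The admissible function space\<close>

lemma adm_space_iff:
  "u \<in> adm_space U \<alpha> \<longleftrightarrow> continuous_on {0..} u \<and> (\<forall>t\<le>0. u t = 0) \<and>
     ((\<lambda>t. lyap t (u t)) \<longlongrightarrow> 0) at_top"
  by (auto simp: adm_space_def C_space_def adm_phi_lyap order_le_less)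

lemma adm_norm_lyap: "adm_norm U \<alpha> u = (SUP t\<in>{0..}. lyap t (u t))"
  by (simp add: adm_norm_def adm_phi_lyap)

lemma adm_spaceD:
  assumes "u \<in> adm_space U \<alpha>"
  shows "continuous_on {0..} u" "t \<le> 0 \<Longrightarrow> u t = 0" "((\<lambda>t. lyap t (u t)) \<longlongrightarrow> 0) at_top"
  using assms by (auto simp: adm_space_iff)

lemma lyap_tendsto_le:
  assumes "((\<lambda>t. f t) \<longlongrightarrow> 0) at_top" and "\<forall>\<^sub>F t in at_top. lyap t (u t) \<le> f t"
  shows "((\<lambda>t. lyap t (u t)) \<longlongrightarrow> 0) at_top"
proof (rule tendsto_sandwich[OF _ assms(2) tendsto_const assms(1)])
  show "\<forall>\<^sub>F t in at_top. 0 \<le> lyap t (u t)"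
    using eventually_ge_at_top[of 0] by eventually_elim (rule lyap_nonneg)
qed

lemma adm_space_diff:
  assumes u: "u \<in> adm_space U \<alpha>" and v: "v \<in> adm_space U \<alpha>"
  shows "(\<lambda>s. u s - v s) \<in> adm_space U \<alpha>"
  unfolding adm_space_iff
proof (intro conjI)
  show "continuous_on {0..} (\<lambda>s. u s - v s)"
    using u v by (intro continuous_intros) (auto simp: adm_spaceD)
  show "((\<lambda>t. lyap t (u t - v t)) \<longlongrightarrow> 0) at_top"
  proof (rule lyap_tendsto_le)
    show "((\<lambda>t. lyap t (u t) + lyap t (v t)) \<longlongrightarrow> 0) at_top"
      using tendsto_add[OF adm_spaceD(3)[OF u] adm_spaceD(3)[OF v]] by simp
    show "\<forall>\<^sub>F t in at_top. lyap t (u t - v t) \<le> lyap t (u t) + lyap t (v t)"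
      using eventually_ge_at_top[of 0] by eventually_elim (rule lyap_diff)
  qed
qed (use u v in \<open>auto simp: adm_spaceD\<close>)

lemma adm_space_scaleR:
  assumes u: "u \<in> adm_space U \<alpha>"
  shows "(\<lambda>s. c *\<^sub>R u s) \<in> adm_space U \<alpha>"
  unfolding adm_space_iff
proof (intro conjI)
  show "continuous_on {0..} (\<lambda>s. c *\<^sub>R u s)"
    using u by (intro continuous_intros) (auto simp: adm_spaceD)
  show "((\<lambda>t. lyap t (c *\<^sub>R u t)) \<longlongrightarrow> 0) at_top"
  proof (rule lyap_tendsto_le)
    show "((\<lambda>t. \<bar>c\<bar> * lyap t (u t)) \<longlongrightarrow> 0) at_top"
      using tendsto_mult_left[OF adm_spaceD(3)[OF u], of "\<bar>c\<bar>"] by simp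
    show "\<forall>\<^sub>F t in at_top. lyap t (c *\<^sub>R u t) \<le> \<bar>c\<bar> * lyap t (u t)"
      using eventually_ge_at_top[of 0] by eventually_elim (rule lyap_scaleR_le)
  qed
qed (use u in \<open>auto simp: adm_spaceD\<close>)

text \<open>
  The function \<open>lyap t (u t)\<close> is small for large \<open>t\<close>, and on the remaining compact interval it is
  dominated by the continuous function \<open>M t * norm (u t)\<close>.
\<close>

lemma lyap_bounded:
  assumes u: "u \<in> adm_space U \<alpha>"
  shows "bdd_above ((\<lambda>t. lyap t (u t)) ` {0..})"
proof -
  have "\<forall>\<^sub>F t in at_top. lyap t (u t) < 1"
    using order_tendstoD(2)[OF adm_spaceD(3)[OF u]] by simp
  then obtain R where R: "\<And>t. R \<le> t \<Longrightarrow> lyap t (u t) < 1"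
    by (auto simp: eventually_at_top_linorder)
  have "continuous_on {0..R} (\<lambda>t. M t * norm (u t))"
    using M_continuous adm_spaceD(1)[OF u]
    by (intro continuous_intros) (auto elim: continuous_on_subset)
  then have "bounded ((\<lambda>t. M t * norm (u t)) ` {0..R})"
    by (intro compact_imp_bounded compact_continuous_image) auto
  then obtain B where B: "\<And>t. t \<in> {0..R} \<Longrightarrow> M t * norm (u t) \<le> B"
    by (auto simp: bounded_real) (metis abs_le_D1 atLeastAtMost_iff)
  have "lyap t (u t) \<le> max 1 B" if "0 \<le> t" for t
    using R[of t] B[of t] lyap_le_norm[OF that, of "u t"] that by (cases "t \<le> R") auto
  then show ?thesis by (intro bdd_aboveI2[where M = "max 1 B"]) auto
qed

lemma lyap_le_adm_norm: "u \<in> adm_space U \<alpha> \<Longrightarrow> 0 \<le> t \<Longrightarrow> lyap t (u t) \<le> adm_norm U \<alpha> u"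
  unfolding adm_norm_lyap by (intro cSUP_upper lyap_bounded) auto

lemma adm_norm_least: "(\<And>t. 0 \<le> t \<Longrightarrow> lyap t (u t) \<le> c) \<Longrightarrow> adm_norm U \<alpha> u \<le> c"
  unfolding adm_norm_lyap by (intro cSUP_least) auto

lemma adm_norm_nonneg: "u \<in> adm_space U \<alpha> \<Longrightarrow> 0 \<le> adm_norm U \<alpha> u"
  using lyap_le_adm_norm[of u 0] lyap_nonneg[of 0 "u 0"] by simp


section \<open>The evolution semigroup and its generator\<close>

text \<open>
  Strong continuity of the family is separate continuity in the vector; it becomes joint because the
  operators are locally bounded, by \<open>M s * exp (\<alpha> * (t - s))\<close>.
\<close>

lemma trajectory_continuous_nonneg:
  assumes w: "continuous_on {0..} w"
  shows "continuous_on {(t, s). 0 \<le> s \<and> s \<le> t} (\<lambda>(t, s). blinfun_apply (U t s) (w s))"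
    (is "continuous_on ?D _")
proof -
  have "((\<lambda>p. blinfun_apply (U (fst p) (snd p)) (w (snd p))) \<longlongrightarrow> blinfun_apply (U (fst q) (snd q)) (w (snd q)))
          (at q within ?D)" if q: "q \<in> ?D" for q
  proof -
    have wc: "continuous_on ?D (\<lambda>p. w (snd p))"
      by (rule continuous_on_compose2[OF w]) (auto intro!: continuous_intros)
    have Mc: "continuous_on ?D (\<lambda>p. M (snd p))"
      by (rule continuous_on_compose2[OF M_continuous]) (auto intro!: continuous_intros)
    have "continuous_on ?D (\<lambda>p. (M (snd p) * exp (\<alpha> * (fst p - snd p))) * norm (w (snd p) - w (snd q)))"
      by (intro continuous_intros wc Mc)
    then have 0: "((\<lambda>p. (M (snd p) * exp (\<alpha> * (fst p - snd p))) * norm (w (snd p) - w (snd q))) \<longlongrightarrow> 0) (at q within ?D)"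
      using q unfolding continuous_on_def by fastforce
    have 1: "((\<lambda>p. blinfun_apply (U (fst p) (snd p)) (w (snd p) - w (snd q))) \<longlongrightarrow> 0) (at q within ?D)"
    proof (rule Lim_null_comparison[OF _ 0])
      have "norm (blinfun_apply (U (fst p) (snd p)) x) \<le> M (snd p) * exp (\<alpha> * (fst p - snd p)) * norm x"
        if "p \<in> ?D" for p x
        using norm_blinfun[of "U (fst p) (snd p)" x]
          mult_right_mono[OF U_bound[of "snd p" "fst p"], of "norm x"] that by auto
      then show "\<forall>\<^sub>F p in at q within ?D. norm (blinfun_apply (U (fst p) (snd p)) (w (snd p) - w (snd q)))
          \<le> M (snd p) * exp (\<alpha> * (fst p - snd p)) * norm (w (snd p) - w (snd q))"
        unfolding eventually_at_topological by blast
    qed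
    have 2: "((\<lambda>p. blinfun_apply (U (fst p) (snd p)) (w (snd q))) \<longlongrightarrow> blinfun_apply (U (fst q) (snd q)) (w (snd q))) (at q within ?D)"
      using U_continuous[of "w (snd q)"] q unfolding continuous_on_def case_prod_beta by blast
    from tendsto_add[OF 1 2] show ?thesis by (simp add: blinfun.diff_right)
  qed
  then show ?thesis unfolding continuous_on_def case_prod_beta by blast
qed

text \<open>
  A function that vanishes on \<open>t \<le> 0\<close> annihilates the unconstrained values \<open>U t s\<close> for negative \<open>s\<close>,
  so its trajectories extend continuously across \<open>s = 0\<close>.  This removes the case distinction at the
  origin from the estimates about the semigroup.
\<close>

lemma trajectory_continuous:
  assumes w: "continuous_on {0..} w" "\<And>t. t \<le> 0 \<Longrightarrow> w t = 0"
  shows "continuous_on {(t, s). s \<le> t} (\<lambda>(t, s). blinfun_apply (U t s) (w s))"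
proof -
  have eq: "{(t, s). s \<le> t} = {(t, s). 0 \<le> s \<and> s \<le> t} \<union> {(t, s). s \<le> (0::real) \<and> s \<le> (t::real)}"
    by auto
  have "continuous_on {(t, s). s \<le> 0 \<and> s \<le> t} (\<lambda>(t, s). blinfun_apply (U t s) (w s))"
    by (rule continuous_on_eq[OF continuous_on_const[of _ 0]]) (auto simp: w(2))
  moreover have "closed {(t, s). 0 \<le> s \<and> s \<le> (t::real)}" "closed {(t, s). s \<le> (0::real) \<and> s \<le> (t::real)}"
    unfolding case_prod_beta by (auto intro!: closed_Collect_conj closed_Collect_le continuous_intros)
  ultimately show ?thesis
    unfolding eq by (intro continuous_on_closed_Un trajectory_continuous_nonneg w(1))
qed

lemma trajectory_compose_continuous:
  assumes w: "continuous_on {0..} w" "\<And>t. t \<le> 0 \<Longrightarrow> w t = 0"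
    and f: "continuous_on S f" and g: "continuous_on S g" and le: "\<And>x. x \<in> S \<Longrightarrow> g x \<le> f x"
  shows "continuous_on S (\<lambda>x. blinfun_apply (U (f x) (g x)) (w (g x)))"
proof -
  have "continuous_on S (\<lambda>x. (f x, g x))" using f g by (intro continuous_intros)
  from continuous_on_compose2[OF trajectory_continuous[OF w] this] le
  show ?thesis by auto
qed

lemma adm_semigroup_eq:
  assumes "u \<in> adm_space U \<alpha>" 
  shows "adm_semigroup U h u s = blinfun_apply (U s (s - h)) (u (s - h))"
  using adm_spaceD(2)[OF assms, of "s - h"] by (simp add: adm_semigroup_def)

lemma adm_semigroup_closed:
  assumes u: "u \<in> adm_space U \<alpha>" and h: "0 \<le> h"
  shows "adm_semigroup U h u \<in> adm_space U \<alpha>"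
proof -
  have "(\<lambda>s. blinfun_apply (U s (s - h)) (u (s - h))) \<in> adm_space U \<alpha>"
    unfolding adm_space_iff
  proof (intro conjI)
    show "continuous_on {0..} (\<lambda>s. blinfun_apply (U s (s - h)) (u (s - h)))"
      using u h by (intro trajectory_compose_continuous) (auto intro!: continuous_intros simp: adm_spaceD)
    show "((\<lambda>s. lyap s (blinfun_apply (U s (s - h)) (u (s - h)))) \<longlongrightarrow> 0) at_top"
    proof (rule lyap_tendsto_le)
      have "((\<lambda>s. lyap (s - h) (u (s - h))) \<longlongrightarrow> 0) at_top"
        by (rule filterlim_compose[OF adm_spaceD(3)[OF u]])
          (auto intro!: filterlim_tendsto_add_at_top[of "\<lambda>_. - h" "- h" _ "\<lambda>s. s", simplified] filterlim_ident)
      from tendsto_mult_left[OF this, of "exp (\<alpha> * h)"]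
      show "((\<lambda>s. exp (\<alpha> * h) * lyap (s - h) (u (s - h))) \<longlongrightarrow> 0) at_top" by simp
      show "\<forall>\<^sub>F s in at_top. lyap s (blinfun_apply (U s (s - h)) (u (s - h))) \<le> exp (\<alpha> * h) * lyap (s - h) (u (s - h))"
        using eventually_ge_at_top[of h] 
      proof eventually_elim
        case (elim s)
        then show ?case using lyap_evolution[of "s - h" s "u (s - h)"] h by simp
      qed
    qed
  qed (use u h in \<open>auto simp: adm_spaceD\<close>)
  moreover have "adm_semigroup U h u = (\<lambda>s. blinfun_apply (U s (s - h)) (u (s - h)))"
    using adm_semigroup_eq[OF u] by blast
  ultimately show ?thesis by simp
qed

lemma difference_quotient_closed:
  assumes "u \<in> adm_space U \<alpha>" "y \<in> adm_space U \<alpha>" "0 \<le> h"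
  shows "(\<lambda>s. (adm_semigroup U h u s - u s) /\<^sub>R h - y s) \<in> adm_space U \<alpha>"
  using assms by (intro adm_space_diff adm_space_scaleR adm_semigroup_closed)

text \<open>
  Far out, both terms are small separately because \<open>v\<close> tends to zero in the norms \<open>lyap\<close>.  On a
  bounded time interval \<open>M\<close> is bounded, and the trajectories of \<open>v\<close> are uniformly continuous there.
\<close>

lemma strong_continuity:
  assumes v: "v \<in> adm_space U \<alpha>" and e: "0 < e"
  obtains d where "0 < d" "d \<le> 1"
    "\<And>s r. 0 \<le> s \<Longrightarrow> s - d \<le> r \<Longrightarrow> r \<le> s \<Longrightarrow> lyap s (blinfun_apply (U s r) (v r) - v s) \<le> e"
proof -
  define e' where "e' = e / (2 * exp \<bar>\<alpha>\<bar>)"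
  have e': "0 < e'" "exp \<bar>\<alpha>\<bar> * e' = e / 2" "e' \<le> e / 2"
    using e by (auto simp: e'_def field_simps)
  have "\<forall>\<^sub>F t in at_top. lyap t (v t) < e'"
    using order_tendstoD(2)[OF adm_spaceD(3)[OF v] e'(1)] .
  then obtain R0 where R0: "\<And>t. R0 \<le> t \<Longrightarrow> lyap t (v t) < e'"
    by (auto simp: eventually_at_top_linorder)
  define R where "R = max 0 R0"
  have R: "0 \<le> R" "\<And>t. R \<le> t \<Longrightarrow> lyap t (v t) < e'"
    using R0 by (auto simp: R_def)
  have "continuous_on {0..R + 1} M" using M_continuous by (rule continuous_on_subset) auto
  then have "bounded (M ` {0..R + 1})"
    by (intro compact_imp_bounded compact_continuous_image) auto
  then obtain B where B: "0 < B" "\<And>t. t \<in> {0..R + 1} \<Longrightarrow> M t \<le> B"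
    unfolding bounded_pos by (metis abs_le_D1 image_eqI real_norm_def)
  define S where "S = ({0..R + 1} \<times> {-1..R + 1}) \<inter> {(t, s). s \<le> t}"
  have "closed {(t, s). s \<le> (t::real)}"
    unfolding case_prod_beta by (auto intro!: closed_Collect_le continuous_intros)
  then have "compact S" unfolding S_def by (intro compact_Int_closed compact_Times) auto
  moreover have "continuous_on S (\<lambda>(t, s). blinfun_apply (U t s) (v s))"
    by (rule continuous_on_subset[OF trajectory_continuous]) (auto simp: S_def adm_spaceD v)
  ultimately have "uniformly_continuous_on S (\<lambda>(t, s). blinfun_apply (U t s) (v s))"
    by (intro compact_uniformly_continuous)
  moreover have "0 < e / B" using e B(1) by simp
  ultimately obtain d where d: "0 < d" and dS: "\<And>p q. p \<in> S \<Longrightarrow> q \<in> S \<Longrightarrow> dist q p < d \<Longrightarrow>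
      dist ((\<lambda>(t, s). blinfun_apply (U t s) (v s)) q) ((\<lambda>(t, s). blinfun_apply (U t s) (v s)) p) < e / B"
    by (rule uniformly_continuous_onE) (rule that, assumption+)
  show ?thesis
  proof (rule that[of "min 1 (d / 2)"])
    fix s r assume s: "0 \<le> s" and r: "s - min 1 (d / 2) \<le> r" "r \<le> s"
    show "lyap s (blinfun_apply (U s r) (v r) - v s) \<le> e"
    proof (cases "s \<le> R + 1")
      case True
      have "(s, s) \<in> S" "(s, r) \<in> S" using s r True by (auto simp: S_def)
      moreover have "dist (s, r) (s, s) < d"
        using r d by (simp add: dist_prod_def dist_real_def)
      ultimately have "norm (blinfun_apply (U s r) (v r) - v s) < e / B"
        using dS[of "(s, s)" "(s, r)"] s by (simp add: dist_norm)
      moreover have "M s \<le> B" "0 < M s" using B(2)[of s] s True M_pos by auto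
      ultimately have "M s * norm (blinfun_apply (U s r) (v r) - v s) \<le> B * (e / B)"
        using B(1) by (intro mult_mono) auto
      then show ?thesis using lyap_le_norm[OF s, of "blinfun_apply (U s r) (v r) - v s"] B(1) by simp
    next
      case False
      have rR: "R \<le> r" "0 \<le> r" using False r R(1) by auto
      have "\<alpha> * (s - r) \<le> \<bar>\<alpha>\<bar> * 1" using r by (intro mult_mono) auto
      then have "exp (\<alpha> * (s - r)) * lyap r (v r) \<le> exp \<bar>\<alpha>\<bar> * e'"
        using R(2)[OF rR(1)] lyap_nonneg[OF rR(2), of "v r"] by (intro mult_mono) auto
      moreover have "lyap s (v s) \<le> e / 2" using R(2)[of s] False e'(3) by simp
      ultimately show ?thesis
        using lyap_evolution[OF rR(2) r(2), of "v r"] e'(2)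
          lyap_diff[OF s, of "blinfun_apply (U s r) (v r)" "v s"] by linarith
    qed
  qed (use d in auto)
qed

text \<open>
  The curve \<open>r \<mapsto> U t r (u r)\<close> runs from \<open>0\<close> to \<open>u t\<close>.  Its left difference quotient at \<open>r\<close> is the image
  under \<open>- U t r\<close> of the difference quotient of the semigroup at \<open>u\<close>, evaluated at \<open>r\<close>.  Convergence in
  the norm of the function space makes the limit uniform in \<open>r\<close>.
\<close>

lemma generator_limit_mild:
  assumes u: "u \<in> adm_space U \<alpha>"
    and lim: "generator_limit (adm_space U \<alpha>) (adm_norm U \<alpha>) (adm_semigroup U) u y" and t: "0 \<le> t"
  shows "((\<lambda>r. blinfun_apply (U t r) (y r)) has_integral - u t) {0..t}"
proof -
  from lim have y: "y \<in> adm_space U \<alpha>"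
    and N: "((\<lambda>h. adm_norm U \<alpha> (\<lambda>s. (adm_semigroup U h u s - u s) /\<^sub>R h - y s)) \<longlongrightarrow> 0) (at_right 0)"
    by (auto simp: generator_limit_def)
  have "((\<lambda>r. - blinfun_apply (U t r) (y r)) has_integral blinfun_apply (U t t) (u t) - blinfun_apply (U t 0) (u 0)) {0..t}"
  proof (rule has_integral_uniform_left_derivative[OF t])
    show "continuous_on {0..t} (\<lambda>r. - blinfun_apply (U t r) (y r))"
      using y by (intro continuous_intros trajectory_compose_continuous) (auto simp: adm_spaceD)
    fix e :: real assume e: "0 < e"
    define c where "c = exp (\<bar>\<alpha>\<bar> * t)"
    have c: "0 < c" by (simp add: c_def)
    have "\<forall>\<^sub>F h in at_right 0. adm_norm U \<alpha> (\<lambda>s. (adm_semigroup U h u s - u s) /\<^sub>R h - y s) < e / c"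
      using order_tendstoD(2)[OF N] e c by simp
    then obtain d where d: "0 < d" and
      dN: "\<And>h. 0 < h \<Longrightarrow> h < d \<Longrightarrow> adm_norm U \<alpha> (\<lambda>s. (adm_semigroup U h u s - u s) /\<^sub>R h - y s) < e / c"
      by (auto simp: eventually_at_right_field)
    show "\<exists>d>0. \<forall>h r. 0 < h \<and> h < d \<and> 0 \<le> r - h \<and> r \<le> t \<longrightarrow>
        norm (blinfun_apply (U t r) (u r) - blinfun_apply (U t (r - h)) (u (r - h)) - h *\<^sub>R (- blinfun_apply (U t r) (y r))) \<le> e * h"
    proof (intro exI conjI allI impI, rule d)
      fix h r assume "0 < h \<and> h < d \<and> 0 \<le> r - h \<and> r \<le> t"
      then have h: "0 < h" "h < d" "0 \<le> r - h" "r \<le> t" "0 \<le> r" by auto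
      define q where "q = (adm_semigroup U h u r - u r) /\<^sub>R h - y r"
      have "lyap r q \<le> e / c"
        using lyap_le_adm_norm[OF difference_quotient_closed[OF u y, of h] h(5)] h dN[OF h(1,2)] by (simp add: q_def)
      moreover have "\<alpha> * (t - r) \<le> \<bar>\<alpha>\<bar> * t"
        using h by (intro mult_mono) auto
      ultimately have "exp (\<alpha> * (t - r)) * lyap r q \<le> c * (e / c)"
        using lyap_nonneg[OF h(5), of q] unfolding c_def by (intro mult_mono) auto
      then have "norm (blinfun_apply (U t r) q) \<le> e"
        using norm_evolution_le[OF h(5,4), of q] c by simp
      then have le: "norm ((- h) *\<^sub>R blinfun_apply (U t r) q) \<le> e * h"
        using h(1) by (simp add: mult.commute)
      have "(- h) *\<^sub>R q = u r - blinfun_apply (U r (r - h)) (u (r - h)) + h *\<^sub>R y r"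
        using h(1) unfolding q_def adm_semigroup_eq[OF u] by (simp add: algebra_simps)
      from arg_cong[OF this, of "blinfun_apply (U t r)"]
      have eq: "(- h) *\<^sub>R blinfun_apply (U t r) q
          = blinfun_apply (U t r) (u r) - blinfun_apply (U t (r - h)) (u (r - h)) - h *\<^sub>R (- blinfun_apply (U t r) (y r))"
        using h by (simp add: blinfun.add_right blinfun.diff_right blinfun.scaleR_right blinfun.minus_right U_comp)
      show "norm (blinfun_apply (U t r) (u r) - blinfun_apply (U t (r - h)) (u (r - h)) - h *\<^sub>R (- blinfun_apply (U t r) (y r))) \<le> e * h"
        using le unfolding eq .
    qed
  qed
  from has_integral_neg[OF this] show ?thesis using t adm_spaceD(2)[OF u, of 0] by simp
qed

text \<open>
  Moving \<open>u\<close> by the semigroup cuts the last window off the integral: \<open>T h u - u\<close> at \<open>s\<close> is the integral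
  of \<open>U s r (v r)\<close> over \<open>[s - h, s]\<close>, whose mean tends to \<open>v s\<close> uniformly in \<open>s\<close> by
  strong continuity.
\<close>

lemma mild_generator_limit:
  assumes u: "u \<in> adm_space U \<alpha>" and v: "v \<in> adm_space U \<alpha>"
    and int: "\<And>t. 0 \<le> t \<Longrightarrow> ((\<lambda>r. blinfun_apply (U t r) (v r)) has_integral - u t) {0..t}"
  shows "generator_limit (adm_space U \<alpha>) (adm_norm U \<alpha>) (adm_semigroup U) u v"
proof -
  let ?Q = "\<lambda>h s. (adm_semigroup U h u s - u s) /\<^sub>R h - v s"
  \<comment> \<open>for \<open>s < h\<close> the window reaches below zero, where \<open>v\<close> vanishes\<close>
  have window: "((\<lambda>r. blinfun_apply (U s r) (v r)) has_integral adm_semigroup U h u s - u s) {s - h..s}"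
    if h: "0 < h" and s: "0 \<le> s" for h s
  proof (cases "h \<le> s")
    case True
    let ?J = "integral {s - h..s} (\<lambda>r. blinfun_apply (U s r) (v r))"
    have "((blinfun_apply (U s (s - h)) \<circ> (\<lambda>r. blinfun_apply (U (s - h) r) (v r))) has_integral
            blinfun_apply (U s (s - h)) (- u (s - h))) {0..s - h}"
      using True by (intro has_integral_linear int blinfun.bounded_linear_right) auto
    then have 1: "((\<lambda>r. blinfun_apply (U s r) (v r)) has_integral - adm_semigroup U h u s) {0..s - h}"
      using True h by (subst has_integral_cong[where g = "blinfun_apply (U s (s - h)) \<circ> (\<lambda>r. blinfun_apply (U (s - h) r) (v r))"])
        (auto simp: U_comp adm_semigroup_eq[OF u] blinfun.minus_right)
    have "continuous_on {s - h..s} (\<lambda>r. blinfun_apply (U s r) (v r))"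
      using v by (intro trajectory_compose_continuous continuous_intros) (auto simp: adm_spaceD)
    then have 2: "((\<lambda>r. blinfun_apply (U s r) (v r)) has_integral ?J) {s - h..s}"
      by (intro integrable_integral integrable_continuous_real)
    have "((\<lambda>r. blinfun_apply (U s r) (v r)) has_integral - adm_semigroup U h u s + ?J) {0..s}"
      using True h by (intro has_integral_combine[OF _ _ 1 2]) auto
    then have "- adm_semigroup U h u s + ?J = - u s"
      using int[OF s] by (rule has_integral_unique)
    then have "?J = adm_semigroup U h u s - u s" by (simp add: algebra_simps)
    with 2 show ?thesis by simp
  next
    case False
    have "((\<lambda>r. blinfun_apply (U s r) (v r)) has_integral 0) {s - h..0}"
      by (rule has_integral_is_0) (simp add: adm_spaceD(2)[OF v])
    then have "((\<lambda>r. blinfun_apply (U s r) (v r)) has_integral 0 + - u s) {s - h..s}"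
      using False s by (intro has_integral_combine[OF _ _ _ int[OF s]]) auto
    moreover have "u (s - h) = 0" using False by (intro adm_spaceD(2)[OF u]) simp
    ultimately show ?thesis by (simp add: adm_semigroup_eq[OF u])
  qed
  have small: "\<exists>d>0. \<forall>h. 0 < h \<and> h < d \<longrightarrow> adm_norm U \<alpha> (?Q h) \<le> e" if e: "0 < e" for e
  proof -
    obtain d where d: "0 < d" "d \<le> 1"
      "\<And>s r. 0 \<le> s \<Longrightarrow> s - d \<le> r \<Longrightarrow> r \<le> s \<Longrightarrow> lyap s (blinfun_apply (U s r) (v r) - v s) \<le> e"
      using strong_continuity[OF v e] by metis
    have "adm_norm U \<alpha> (?Q h) \<le> e" if h: "0 < h" "h < d" for h
    proof (rule adm_norm_least)
      fix s :: real assume s: "0 \<le> s"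
      have "((\<lambda>r. blinfun_apply (U s r) (v r) - v s) has_integral (adm_semigroup U h u s - u s) - h *\<^sub>R v s) {s - h..s}"
        using has_integral_diff[OF window[OF h(1) s] has_integral_const_real[of "v s" "s - h" s]] h by simp
      then have I: "integral {s - h..s} (\<lambda>r. blinfun_apply (U s r) (v r) - v s) = h *\<^sub>R ?Q h s"
        and int: "(\<lambda>r. blinfun_apply (U s r) (v r) - v s) integrable_on {s - h..s}"
        using h by (auto simp: integral_unique has_integral_integrable algebra_simps)
      have "lyap s (h *\<^sub>R ?Q h s) \<le> integral {s - h..s} (\<lambda>_. e)"
        unfolding I[symmetric] using h d(3)[OF s] by (intro lyap_integral s int) auto
      also have "\<dots> = h * e" using h by simp
      finally show "lyap s (?Q h s) \<le> e" using h by (simp add: lyap_scaleR[OF s])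
    qed
    with d(1) show ?thesis by blast
  qed
  have "((\<lambda>h. adm_norm U \<alpha> (?Q h)) \<longlongrightarrow> 0) (at_right 0)"
  proof (rule tendstoI)
    fix e :: real assume "0 < e"
    then obtain d where d: "0 < d" "\<And>h. 0 < h \<Longrightarrow> h < d \<Longrightarrow> adm_norm U \<alpha> (?Q h) \<le> e / 2"
      using small[of "e / 2"] by auto
    have "dist (adm_norm U \<alpha> (?Q h)) 0 < e" if "0 < h" "h < d" for h
      using d(2)[OF that] adm_norm_nonneg[OF difference_quotient_closed[OF u v, of h]] that \<open>0 < e\<close>
      by (simp add: dist_real_def)
    then show "\<forall>\<^sub>F h in at_right 0. dist (adm_norm U \<alpha> (?Q h)) 0 < e"
      using d(1) by (auto simp: eventually_at_right_field)
  qed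
  then show ?thesis using v by (simp add: generator_limit_def)
qed

text \<open>
  The norm of the function space dominates the norm of each value, so limits are determined pointwise.
\<close>

lemma generator_limit_unique:
  assumes u: "u \<in> adm_space U \<alpha>"
    and y: "generator_limit (adm_space U \<alpha>) (adm_norm U \<alpha>) (adm_semigroup U) u y"
    and z: "generator_limit (adm_space U \<alpha>) (adm_norm U \<alpha>) (adm_semigroup U) u z"
  shows "y = z"
proof
  fix s
  have pointwise: "((\<lambda>h. (adm_semigroup U h u s - u s) /\<^sub>R h) \<longlongrightarrow> w s) (at_right 0)"
    if w: "generator_limit (adm_space U \<alpha>) (adm_norm U \<alpha>) (adm_semigroup U) u w" and s: "0 \<le> s" for w
  proof -
    from w have wE: "w \<in> adm_space U \<alpha>"
      and N: "((\<lambda>h. adm_norm U \<alpha> (\<lambda>s. (adm_semigroup U h u s - u s) /\<^sub>R h - w s)) \<longlongrightarrow> 0) (at_right 0)"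
      by (auto simp: generator_limit_def)
    have "\<forall>\<^sub>F h in at_right 0. norm ((adm_semigroup U h u s - u s) /\<^sub>R h - w s)
        \<le> adm_norm U \<alpha> (\<lambda>s. (adm_semigroup U h u s - u s) /\<^sub>R h - w s)"
      using eventually_at_right_less[of 0]
    proof eventually_elim
      case (elim h)
      let ?Q = "\<lambda>s. (adm_semigroup U h u s - u s) /\<^sub>R h - w s"
      have "norm (?Q s) \<le> lyap s (?Q s)" by (rule norm_le_lyap[OF s])
      also have "\<dots> \<le> adm_norm U \<alpha> ?Q"
        using lyap_le_adm_norm[OF difference_quotient_closed[OF u wE, of h] s] elim by simp
      finally show ?case .
    qed
    from Lim_null_comparison[OF this N] show ?thesis by (simp add: LIM_zero_iff)
  qed
  show "y s = z s"
  proof (cases "0 \<le> s")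
    case True
    show ?thesis by (rule tendsto_unique[OF _ pointwise[OF y True] pointwise[OF z True]]) simp
  next
    case False
    with y z show ?thesis by (simp add: generator_limit_def adm_spaceD(2))
  qed
qed

lemma adm_generatorI:
  assumes "u \<in> adm_space U \<alpha>"
    and "generator_limit (adm_space U \<alpha>) (adm_norm U \<alpha>) (adm_semigroup U) u y"
  shows "u \<in> adm_generator_domain U \<alpha>" "adm_generator U \<alpha> u = y"
proof -
  show "u \<in> adm_generator_domain U \<alpha>"
    unfolding adm_generator_domain_def generator_domain_def using assms by blast
  show "adm_generator U \<alpha> u = y"
    unfolding adm_generator_def generator_def
    by (rule the_equality) (use assms generator_limit_unique in blast)+
qed

lemma adm_generatorD:
  assumes "u \<in> adm_generator_domain U \<alpha>"
  shows "u \<in> adm_space U \<alpha>"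
    "generator_limit (adm_space U \<alpha>) (adm_norm U \<alpha>) (adm_semigroup U) u (adm_generator U \<alpha> u)"
proof -
  from assms obtain y where u: "u \<in> adm_space U \<alpha>"
    and y: "generator_limit (adm_space U \<alpha>) (adm_norm U \<alpha>) (adm_semigroup U) u y"
    by (auto simp: adm_generator_domain_def generator_domain_def)
  show "u \<in> adm_space U \<alpha>" by fact
  show "generator_limit (adm_space U \<alpha>) (adm_norm U \<alpha>) (adm_semigroup U) u (adm_generator U \<alpha> u)"
    using y adm_generatorI(2)[OF u y] by simp
qed


section \<open>A negative exponent makes the generator invertible\<close>

text \<open>
  The candidate for the inverse of the generator, given by variation of constants.
\<close>

definition mild :: "(real \<Rightarrow> 'a) \<Rightarrow> real \<Rightarrow> 'a" where
  "mild v t = - integral {0..t} (\<lambda>r. blinfun_apply (U t r) (v r))"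

lemma mild_has_integral:
  assumes "v \<in> adm_space U \<alpha>"
  shows "((\<lambda>r. blinfun_apply (U t r) (v r)) has_integral - mild v t) {0..t}"
proof -
  have "continuous_on {0..t} (\<lambda>r. blinfun_apply (U t r) (v r))"
    using assms by (intro trajectory_compose_continuous continuous_intros) (auto simp: adm_spaceD)
  then show ?thesis
    by (simp add: mild_def integrable_continuous_real integrable_integral)
qed

lemma mild_unique:
  assumes "u \<in> adm_space U \<alpha>" "v \<in> adm_space U \<alpha>"
    and "\<And>t. 0 \<le> t \<Longrightarrow> ((\<lambda>r. blinfun_apply (U t r) (v r)) has_integral - u t) {0..t}"
  shows "u = mild v"
proof
  fix t show "u t = mild v t"
  proof (cases "0 \<le> t")
    case True
    from has_integral_unique[OF assms(3)[OF True] mild_has_integral[OF assms(2)]]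
    show ?thesis by simp
  next
    case False
    then show ?thesis using adm_spaceD(2)[OF assms(1), of t] by (simp add: mild_def)
  qed
qed

lemma generator_mild:
  assumes "u \<in> adm_generator_domain U \<alpha>"
  shows "adm_generator U \<alpha> u \<in> adm_space U \<alpha>" "u = mild (adm_generator U \<alpha> u)"
proof -
  note u = adm_generatorD[OF assms]
  show y: "adm_generator U \<alpha> u \<in> adm_space U \<alpha>" using u(2) by (simp add: generator_limit_def)
  show "u = mild (adm_generator U \<alpha> u)"
    by (intro mild_unique u(1) y generator_limit_mild[OF u])
qed

lemma mild_generator:
  assumes "v \<in> adm_space U \<alpha>" "mild v \<in> adm_space U \<alpha>"
  shows "mild v \<in> adm_generator_domain U \<alpha>" "adm_generator U \<alpha> (mild v) = v"
proof -
  have "generator_limit (adm_space U \<alpha>) (adm_norm U \<alpha>) (adm_semigroup U) (mild v) v"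
    using assms by (intro mild_generator_limit mild_has_integral)
  from adm_generatorI[OF assms(2) this]
  show "mild v \<in> adm_generator_domain U \<alpha>" "adm_generator U \<alpha> (mild v) = v" .
qed

text \<open>
  After rescaling, the integral runs over the fixed interval \<open>[0, 1]\<close>, so that continuity of parameter
  integrals applies.
\<close>

lemma mild_continuous:
  assumes v: "v \<in> adm_space U \<alpha>"
  shows "continuous_on {0..} (mild v)"
proof -
  have eq: "mild v t = - (t *\<^sub>R integral (cbox 0 1) (\<lambda>r. blinfun_apply (U t (t * r)) (v (t * r))))" if t: "0 \<le> t" for t
  proof (cases "t = 0")
    case False
    with t have "0 < t" by simp
    have "((\<lambda>r. blinfun_apply (U t (t * r)) (v (t * r))) has_integral (1 / \<bar>t\<bar>) *\<^sub>R - mild v t) ((\<lambda>x. x / t) ` {0..t})"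
      using has_integral_stretch_real[OF mild_has_integral[OF v, of t], of t]
        \<open>0 < t\<close> by simp
    moreover have "(\<lambda>x. x / t) ` {0..t} = {0..1}"
      using \<open>0 < t\<close> by (simp add: image_divide_atLeastAtMost)
    ultimately have "((\<lambda>r. blinfun_apply (U t (t * r)) (v (t * r))) has_integral - mild v t /\<^sub>R t) {0..1}"
      using \<open>0 < t\<close> by (simp add: inverse_eq_divide)
    then have "integral {0..1} (\<lambda>r. blinfun_apply (U t (t * r)) (v (t * r))) = - mild v t /\<^sub>R t"
      by (rule integral_unique)
    then show ?thesis using \<open>0 < t\<close> by simp
  qed (simp add: mild_def)
  have "continuous_on ({0..} \<times> cbox 0 1) (\<lambda>p. blinfun_apply (U (fst p) (fst p * snd p)) (v (fst p * snd p)))"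
    using v by (intro trajectory_compose_continuous continuous_intros)
      (auto simp: adm_spaceD intro: mult_left_le)
  then have "continuous_on ({0..} \<times> cbox 0 1) (\<lambda>(t, r). blinfun_apply (U t (t * r)) (v (t * r)))"
    by (simp add: case_prod_beta)
  then have "continuous_on {0..} (\<lambda>t. - (t *\<^sub>R integral (cbox 0 1) (\<lambda>r. blinfun_apply (U t (t * r)) (v (t * r)))))"
    by (intro continuous_intros integral_continuous_on_param)
  then show ?thesis by (rule continuous_on_eq) (simp add: eq)
qed

text \<open>
  Any weight decaying like \<open>exp (\<alpha> * r)\<close> makes its product with the kernel independent of \<open>r\<close>.  Hence
  a forcing that is at most \<open>e\<close>, up to a transient of size \<open>c\<close> living before time \<open>R\<close>, is estimated by
  one elementary integral.  The case \<open>c = 0\<close> gives the operator bound, small \<open>e\<close> the decay at infinity.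
\<close>

lemma lyap_mild:
  assumes \<alpha>: "\<alpha> < 0" and v: "v \<in> adm_space U \<alpha>" and t: "0 \<le> t" and c: "0 \<le> c" "0 \<le> e"
    and le: "\<And>r. 0 \<le> r \<Longrightarrow> lyap r (v r) \<le> e + c * exp (\<alpha> * (r - R))"
  shows "lyap t (mild v t) \<le> e / \<bar>\<alpha>\<bar> + c * t * exp (\<alpha> * (t - R))"
proof -
  let ?g = "\<lambda>r. e * exp (\<alpha> * (t - r)) + c * exp (\<alpha> * (t - R))"
  have "((\<lambda>r. - e / \<alpha> * exp (\<alpha> * (t - r)) + r * (c * exp (\<alpha> * (t - R)))) has_vector_derivative ?g r) (at r within {0..t})" for r
    unfolding has_real_derivative_iff_has_vector_derivative[symmetric]
    using \<alpha> by (auto intro!: derivative_eq_intros)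
  from fundamental_theorem_of_calculus[OF t this]
  have g: "(?g has_integral (- e / \<alpha> * exp (\<alpha> * (t - t)) + t * (c * exp (\<alpha> * (t - R))))
      - (- e / \<alpha> * exp (\<alpha> * (t - 0)) + 0 * (c * exp (\<alpha> * (t - R))))) {0..t}" .
  have "lyap t (integral {0..t} (\<lambda>r. blinfun_apply (U t r) (v r))) \<le> integral {0..t} ?g"
  proof (rule lyap_integral[OF t])
    fix r assume r: "r \<in> {0..t}"
    then have "lyap t (blinfun_apply (U t r) (v r)) \<le> exp (\<alpha> * (t - r)) * lyap r (v r)"
      by (intro lyap_evolution) auto
    also have "\<dots> \<le> exp (\<alpha> * (t - r)) * (e + c * exp (\<alpha> * (r - R)))"
      using r by (intro mult_left_mono le) auto
    also have "\<dots> = ?g r" by (simp add: algebra_simps flip: exp_add)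
    finally show "lyap t (blinfun_apply (U t r) (v r)) \<le> ?g r" .
  qed (use mild_has_integral[OF v] g in \<open>auto simp: has_integral_integrable\<close>)
  also have "\<dots> = e / \<bar>\<alpha>\<bar> * (1 - exp (\<alpha> * t)) + c * t * exp (\<alpha> * (t - R))"
    using integral_unique[OF g] \<alpha> by (simp add: field_simps)
  also have "\<dots> \<le> e / \<bar>\<alpha>\<bar> * 1 + c * t * exp (\<alpha> * (t - R))"
    using c by (intro add_right_mono mult_left_mono divide_nonneg_nonneg) auto
  finally show ?thesis by (simp add: mild_def lyap_minus t)
qed

lemma mild_in_space:
  assumes \<alpha>: "\<alpha> < 0" and v: "v \<in> adm_space U \<alpha>"
  shows "mild v \<in> adm_space U \<alpha>"
  unfolding adm_space_iff
proof (intro conjI mild_continuous v)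
  show "\<forall>t\<le>0. mild v t = 0" by (auto simp: mild_def order_le_less)
  show "((\<lambda>t. lyap t (mild v t)) \<longlongrightarrow> 0) at_top"
  proof (rule tendstoI)
    fix e :: real assume e: "0 < e"
    \<comment> \<open>chosen such that the stationary part of the estimate is \<open>e / 2\<close>\<close>
    define e' where "e' = e * \<bar>\<alpha>\<bar> / 2"
    have "0 < \<bar>\<alpha>\<bar>" using \<alpha> by simp
    then have e': "0 < e'" "e' / \<bar>\<alpha>\<bar> = e / 2"
      using mult_pos_pos[OF e, of "\<bar>\<alpha>\<bar>"] by (simp_all add: e'_def)
    define c where "c = adm_norm U \<alpha> v"
    have c: "0 \<le> c" using adm_norm_nonneg[OF v] by (simp add: c_def)
    have "\<forall>\<^sub>F t in at_top. lyap t (v t) < e'"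
      using order_tendstoD(2)[OF adm_spaceD(3)[OF v] e'(1)] .
    then obtain R where R: "\<And>r. R \<le> r \<Longrightarrow> lyap r (v r) < e'"
      by (auto simp: eventually_at_top_linorder)
    \<comment> \<open>for \<open>r \<le> R\<close> the exponential is at least one, so the second term covers the norm of \<open>v\<close>\<close>
    have le: "lyap r (v r) \<le> e' + c * exp (\<alpha> * (r - R))" if r: "0 \<le> r" for r
    proof (cases "R \<le> r")
      case True
      have "0 \<le> c * exp (\<alpha> * (r - R))" using c by simp
      then show ?thesis using R[OF True] by linarith
    next
      case False
      then have "1 \<le> exp (\<alpha> * (r - R))" using \<alpha> by (simp add: mult_nonpos_nonpos)
      then have "c * 1 \<le> c * exp (\<alpha> * (r - R))" using c by (intro mult_left_mono)
      then show ?thesis using lyap_le_adm_norm[OF v r] e'(1) by (simp add: c_def)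
    qed
    have "((\<lambda>t. c * t * exp (\<alpha> * (t - R))) \<longlongrightarrow> 0) at_top"
      using \<alpha> by real_asymp
    then have "\<forall>\<^sub>F t in at_top. c * t * exp (\<alpha> * (t - R)) < e / 2"
      using e by (intro order_tendstoD(2)) auto
    then show "\<forall>\<^sub>F t in at_top. dist (lyap t (mild v t)) 0 < e"
      using eventually_ge_at_top[of 0]
    proof eventually_elim
      case (elim t)
      then show ?case
        using lyap_mild[OF \<alpha> v elim(2) c _ le] e' lyap_nonneg[OF elim(2), of "mild v t"]
        by (simp add: dist_real_def)
    qed
  qed
qed

lemma adm_norm_mild:
  assumes \<alpha>: "\<alpha> < 0" and v: "v \<in> adm_space U \<alpha>"
  shows "adm_norm U \<alpha> (mild v) \<le> inverse \<bar>\<alpha>\<bar> * adm_norm U \<alpha> v"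
proof (rule adm_norm_least)
  fix t :: real assume "0 \<le> t"
  from lyap_mild[OF \<alpha> v this order_refl[of 0] adm_norm_nonneg[OF v], of 0] lyap_le_adm_norm[OF v]
  show "lyap t (mild v t) \<le> inverse \<bar>\<alpha>\<bar> * adm_norm U \<alpha> v"
    by (simp add: divide_inverse_commute)
qed

theorem negative_exponent_invertible:
  assumes \<alpha>: "\<alpha> < 0"
  shows "invertible_operator (adm_space U \<alpha>) (adm_norm U \<alpha>) (adm_generator_domain U \<alpha>) (adm_generator U \<alpha>)"
proof -
  have bij: "bij_betw (adm_generator U \<alpha>) (adm_generator_domain U \<alpha>) (adm_space U \<alpha>)"
  proof (rule bij_betw_byWitness[where f' = mild])
    show "\<forall>u\<in>adm_generator_domain U \<alpha>. mild (adm_generator U \<alpha> u) = u"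
      using generator_mild(2) by metis
  qed (use generator_mild(1) mild_generator mild_in_space[OF \<alpha>] in auto)
  have "inv_into (adm_generator_domain U \<alpha>) (adm_generator U \<alpha>) v = mild v" if "v \<in> adm_space U \<alpha>" for v
    by (intro inv_into_f_eq bij_betw_imp_inj_on[OF bij] mild_generator that mild_in_space[OF \<alpha>])
  then show ?thesis
    unfolding invertible_operator_def using bij adm_norm_mild[OF \<alpha>] by auto
qed


section \<open>An invertible generator forces exponential decay\<close>

text \<open>
  The cutoff \<open>\<eta>\<close> below is the trapezoid of height one over \<open>[s, s + T]\<close>, with flanks of length one,
  whence the integral is at least \<open>T - 2\<close>.  Because \<open>v = \<eta> U(\<cdot>, s) x\<close> has compact support, it lies in the
  function space whatever the behaviour of the orbit at infinity; that its preimage lies in the function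
  space as well is the information that invertibility provides.
\<close>

lemma invertible_cutoff_estimate:
  assumes "invertible_operator (adm_space U \<alpha>) (adm_norm U \<alpha>) (adm_generator_domain U \<alpha>) (adm_generator U \<alpha>)"
  obtains K where "0 \<le> K"
    "\<And>s t T x c. 0 \<le> s \<Longrightarrow> 2 \<le> T \<Longrightarrow> s + T \<le> t \<Longrightarrow>
       (\<And>r. s \<le> r \<Longrightarrow> r \<le> s + T \<Longrightarrow> lyap r (blinfun_apply (U r s) x) \<le> c) \<Longrightarrow>
       (T - 2) * lyap t (blinfun_apply (U t s) x) \<le> K * c"
proof -
  let ?G = "adm_generator U \<alpha>" and ?D = "adm_generator_domain U \<alpha>"
  from assms obtain K where bij: "bij_betw ?G ?D (adm_space U \<alpha>)"
    and K: "\<And>y. y \<in> adm_space U \<alpha> \<Longrightarrow> adm_norm U \<alpha> (inv_into ?D ?G y) \<le> K * adm_norm U \<alpha> y"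
    by (auto simp: invertible_operator_def)
  show ?thesis
  proof (rule that[of "\<bar>K\<bar>"])
    fix s t T c :: real and x
    assume s: "0 \<le> s" and T: "2 \<le> T" and t: "s + T \<le> t"
      and c: "\<And>r. s \<le> r \<Longrightarrow> r \<le> s + T \<Longrightarrow> lyap r (blinfun_apply (U r s) x) \<le> c"
    define \<eta> where "\<eta> r = max 0 (min 1 (min (r - s) (s + T - r)))" for r
    have \<eta>: "0 \<le> \<eta> r" "\<eta> r \<le> 1" "r \<le> s \<or> s + T \<le> r \<Longrightarrow> \<eta> r = 0"
      "s + 1 \<le> r \<Longrightarrow> r \<le> s + T - 1 \<Longrightarrow> \<eta> r = 1" for r
      using T by (auto simp: \<eta>_def)
    have c\<eta>: "continuous_on A \<eta>" for A unfolding \<eta>_def by (intro continuous_intros)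
    \<comment> \<open>the maximum keeps \<open>U\<close> within its domain for \<open>r < s\<close>, where \<open>\<eta>\<close> vanishes\<close>
    define v where "v r = \<eta> r *\<^sub>R blinfun_apply (U (max s r) s) x" for r
    have cU: "continuous_on {0..} (\<lambda>r. blinfun_apply (U (max s r) s) x)"
    proof -
      have "continuous_on {0..} (\<lambda>r. (max s r, s))" by (intro continuous_intros)
      moreover have "(\<lambda>r. (max s r, s)) ` {0..} \<subseteq> {(t, s). 0 \<le> s \<and> s \<le> t}" using s by auto
      ultimately show ?thesis using continuous_on_compose2[OF U_continuous[of x]] by fastforce
    qed
    have lv: "lyap r (v r) \<le> c" if r: "0 \<le> r" for r
    proof (cases "s \<le> r \<and> r \<le> s + T")
      case True
      have "\<eta> r * lyap r (blinfun_apply (U r s) x) \<le> 1 * lyap r (blinfun_apply (U r s) x)"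
        using lyap_nonneg[OF r] \<eta>(2) by (intro mult_right_mono)
      also have "\<dots> \<le> c" using c True by simp
      finally show ?thesis using True \<eta>(1) by (simp add: v_def lyap_scaleR[OF r] max_absorb2)
    next
      case False
      then show ?thesis using \<eta>(3)[of r] order_trans[OF lyap_nonneg c[of s]] s T by (auto simp: v_def)
    qed
    have "((\<lambda>t. lyap t (v t)) \<longlongrightarrow> 0) at_top"
    proof (rule tendsto_eventually)
      show "\<forall>\<^sub>F t in at_top. lyap t (v t) = 0"
        using eventually_ge_at_top[of "s + T"] by eventually_elim (simp add: v_def \<eta>(3))
    qed
    then have vE: "v \<in> adm_space U \<alpha>"
      unfolding adm_space_iff using s by (auto simp: v_def \<eta>(3) intro!: continuous_intros c\<eta> cU)
    define u where "u = inv_into ?D ?G v"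
    have "v \<in> ?G ` ?D" using bij vE by (simp add: bij_betw_def)
    then have u: "u \<in> ?D" "?G u = v" unfolding u_def by (rule inv_into_into, rule f_inv_into_f)
    \<comment> \<open>the evolution carries every \<open>v r\<close> to a multiple of the same vector\<close>
    have "blinfun_apply (U t r) (v r) = \<eta> r *\<^sub>R blinfun_apply (U t s) x" if r: "r \<in> {0..t}" for r
      using r s \<eta>(3)[of r] by (cases "s \<le> r") (auto simp: v_def blinfun.scaleR_right U_comp max_absorb2)
    then have "integral {0..t} (\<lambda>r. blinfun_apply (U t r) (v r)) = integral {0..t} (\<lambda>r. \<eta> r *\<^sub>R blinfun_apply (U t s) x)"
      by (rule integral_cong)
    also have "\<dots> = integral {0..t} \<eta> *\<^sub>R blinfun_apply (U t s) x"
      by (intro integral_unique has_integral_scaleR_left integrable_integral integrable_continuous_real c\<eta>)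
    finally have "u t = - (integral {0..t} \<eta> *\<^sub>R blinfun_apply (U t s) x)"
      using fun_cong[OF generator_mild(2)[OF u(1)], of t] u(2) by (simp add: mild_def)
    moreover have "T - 2 \<le> integral {0..t} \<eta>"
    proof -
      have "T - 2 = integral {s + 1..s + T - 1} (\<lambda>_. 1::real)" using T by simp
      also have "\<dots> = integral {s + 1..s + T - 1} \<eta>" by (rule integral_cong) (simp add: \<eta>(4))
      also have "\<dots> \<le> integral {0..t} \<eta>"
        using s t \<eta>(1) by (intro integral_subset_le integrable_continuous_real c\<eta>) auto
      finally show ?thesis .
    qed
    moreover have t0: "0 \<le> t" using s t T by simp
    ultimately have "(T - 2) * lyap t (blinfun_apply (U t s) x) \<le> lyap t (u t)"
      using T lyap_nonneg[OF t0, of "blinfun_apply (U t s) x"] by (auto simp: lyap_minus lyap_scaleR intro!: mult_right_mono)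
    also have "\<dots> \<le> adm_norm U \<alpha> u" using adm_generatorD(1)[OF u(1)] t0 by (rule lyap_le_adm_norm)
    also have "\<dots> \<le> K * adm_norm U \<alpha> v" unfolding u_def by (rule K[OF vE])
    also have "\<dots> \<le> \<bar>K\<bar> * c"
      using adm_norm_nonneg[OF vE] adm_norm_least[of v c] lv by (intro mult_mono) auto
    finally show "(T - 2) * lyap t (blinfun_apply (U t s) x) \<le> \<bar>K\<bar> * c" .
  qed simp
qed

lemma lyap_iterate_half:
  assumes T: "0 \<le> T"
    and half: "\<And>s x. 0 \<le> s \<Longrightarrow> lyap (s + T) (blinfun_apply (U (s + T) s) x) \<le> lyap s x / 2"
    and s: "0 \<le> s"
  shows "lyap (s + real n * T) (blinfun_apply (U (s + real n * T) s) x) \<le> lyap s x / 2 ^ n"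
proof (induction n)
  case 0 then show ?case using s by simp
next
  case (Suc n)
  let ?r = "s + real n * T"
  have r: "s \<le> ?r" "s + real (Suc n) * T = ?r + T" using T by (auto simp: algebra_simps)
  have "lyap (?r + T) (blinfun_apply (U (?r + T) ?r) (blinfun_apply (U ?r s) x)) \<le> lyap ?r (blinfun_apply (U ?r s) x) / 2"
    using r s by (intro half) auto
  moreover have "blinfun_apply (U (?r + T) ?r) (blinfun_apply (U ?r s) x) = blinfun_apply (U (?r + T) s) x"
    using r(1) s T by (intro U_comp) auto
  ultimately have "lyap (?r + T) (blinfun_apply (U (?r + T) s) x) \<le> lyap ?r (blinfun_apply (U ?r s) x) / 2"
    by simp
  also have "\<dots> \<le> (lyap s x / 2 ^ n) / 2" using Suc by (intro divide_right_mono) auto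
  finally show ?case unfolding r(2) by simp
qed

text \<open>
  Boundedness of the orbits comes first; inserted back into the cutoff estimate, it gives a fixed bound
  for \<open>T - 2\<close> times the size of the orbit at time \<open>s + T\<close>, so that a long interval halves it.  The
  function \<open>M\<close> enters only in the last step, through \<open>lyap s x \<le> M s * norm x\<close>.
\<close>

theorem invertible_exponential_decay:
  assumes inv: "invertible_operator (adm_space U \<alpha>) (adm_norm U \<alpha>) (adm_generator_domain U \<alpha>) (adm_generator U \<alpha>)"
  obtains \<nu> C where "0 < \<nu>" "0 < C" "exponent_bound U (- \<nu>) (\<lambda>s. C * M s)"
proof -
  obtain K where K: "0 \<le> K"
    and est: "\<And>s t T x c. 0 \<le> s \<Longrightarrow> 2 \<le> T \<Longrightarrow> s + T \<le> t \<Longrightarrow>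
       (\<And>r. s \<le> r \<Longrightarrow> r \<le> s + T \<Longrightarrow> lyap r (blinfun_apply (U r s) x) \<le> c) \<Longrightarrow>
       (T - 2) * lyap t (blinfun_apply (U t s) x) \<le> K * c"
    using invertible_cutoff_estimate[OF inv] by metis
  define C where "C = (1 + K) * exp (\<bar>\<alpha>\<bar> * 3)"
  have C: "0 < C" using K by (simp add: C_def)
  \<comment> \<open>over the short time 3 the exponent itself bounds the growth\<close>
  have short: "lyap r (blinfun_apply (U r s) x) \<le> exp (\<bar>\<alpha>\<bar> * 3) * lyap s x"
    if "0 \<le> s" "s \<le> r" "r \<le> s + 3" for s r x
  proof -
    have "\<alpha> * (r - s) \<le> \<bar>\<alpha>\<bar> * 3" using that by (intro mult_mono) auto
    then have "exp (\<alpha> * (r - s)) * lyap s x \<le> exp (\<bar>\<alpha>\<bar> * 3) * lyap s x"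
      using lyap_nonneg[OF that(1)] by (intro mult_right_mono) auto
    then show ?thesis using lyap_evolution[OF that(1,2), of x] by linarith
  qed
  \<comment> \<open>beyond time 3 the cutoff estimate with \<open>T = 3\<close> takes over, where \<open>T - 2 = 1\<close>\<close>
  have stable: "lyap t (blinfun_apply (U t s) x) \<le> C * lyap s x" if s: "0 \<le> s" "s \<le> t" for s t x
  proof -
    have L: "0 \<le> exp (\<bar>\<alpha>\<bar> * 3) * lyap s x" using lyap_nonneg[OF s(1)] by simp
    have "lyap t (blinfun_apply (U t s) x) \<le> exp (\<bar>\<alpha>\<bar> * 3) * lyap s x
        \<or> lyap t (blinfun_apply (U t s) x) \<le> K * (exp (\<bar>\<alpha>\<bar> * 3) * lyap s x)"
      using short[of s t x] est[OF s(1), of 3 t x, OF _ _ short] s by (cases "t \<le> s + 3") auto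
    then show ?thesis
      using L mult_nonneg_nonneg[OF K L] by (auto simp: C_def algebra_simps)
  qed
  \<comment> \<open>with this length \<open>T - 2 = 1 + 2 K C\<close> is more than twice the bound \<open>K C\<close> of the cutoff estimate\<close>
  define T where "T = 3 + 2 * (K * C)"
  have T: "0 < T" "2 \<le> T" using K C by (auto simp: T_def add_pos_nonneg)
  have half: "lyap (s + T) (blinfun_apply (U (s + T) s) x) \<le> lyap s x / 2" if s: "0 \<le> s" for s x
  proof -
    have "(T - 2) * lyap (s + T) (blinfun_apply (U (s + T) s) x) \<le> K * (C * lyap s x)"
      using s T by (intro est stable) auto
    also have "\<dots> \<le> (T - 2) * (lyap s x / 2)"
      using lyap_nonneg[OF s, of x] by (simp add: T_def algebra_simps)
    finally show ?thesis using K C by (subst (asm) mult_le_cancel_left_pos) (auto simp: T_def add_pos_nonneg)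
  qed
  \<comment> \<open>the rate of halving once per time \<open>T\<close>\<close>
  define \<nu> where "\<nu> = ln 2 / T"
  have \<nu>: "0 < \<nu>" using T by (simp add: \<nu>_def)
  have decay: "lyap t (blinfun_apply (U t s) x) \<le> 2 * C * exp (- \<nu> * (t - s)) * lyap s x"
    if s: "0 \<le> s" "s \<le> t" for s t x
  proof -
    \<comment> \<open>the number of complete halvings; discarding the incomplete one costs the factor 2\<close>
    define n where "n = nat \<lfloor>(t - s) / T\<rfloor>"
    have "real n = of_int \<lfloor>(t - s) / T\<rfloor>" using s T by (simp add: n_def)
    then have n: "real n \<le> (t - s) / T" "(t - s) / T \<le> real n + 1" by linarith+
    let ?r = "s + real n * T"
    have r: "s \<le> ?r" "?r \<le> t" using n(1) T by (auto simp: field_simps)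
    have "lyap t (blinfun_apply (U t s) x) \<le> C * lyap ?r (blinfun_apply (U ?r s) x)"
      using stable[of ?r t "blinfun_apply (U ?r s) x"] r s by (simp add: U_comp)
    also have "\<dots> \<le> C * (lyap s x / 2 ^ n)"
      using lyap_iterate_half[OF _ half s(1)] T C by (intro mult_left_mono) auto
    also have "\<dots> = C * lyap s x * exp (- ln 2 * real n)"
      by (simp add: exp_minus exp_of_nat2_mult divide_inverse)
    also have "\<dots> \<le> C * lyap s x * exp (ln 2 - \<nu> * (t - s))"
    proof -
      have "\<nu> * (t - s) = ln 2 * ((t - s) / T)" by (simp add: \<nu>_def)
      also have "\<dots> \<le> ln 2 * (real n + 1)" using n(2) by (intro mult_left_mono) auto
      finally have "- ln 2 * real n \<le> ln 2 - \<nu> * (t - s)" by (simp add: algebra_simps)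
      then show ?thesis using C lyap_nonneg[OF s(1), of x] by (intro mult_left_mono) auto
    qed
    also have "\<dots> = 2 * C * exp (- \<nu> * (t - s)) * lyap s x" by (simp add: exp_diff exp_minus divide_inverse mult_ac)
    finally show ?thesis .
  qed
  have "norm (U t s) \<le> 2 * C * M s * exp (- \<nu> * (t - s))" if s: "0 \<le> s" "s \<le> t" for s t
  proof (rule norm_blinfun_bound)
    show "0 \<le> 2 * C * M s * exp (- \<nu> * (t - s))" using C M_pos[OF s(1)] by simp
    fix x
    have "norm (blinfun_apply (U t s) x) \<le> 2 * C * exp (- \<nu> * (t - s)) * lyap s x"
      using decay[OF s, of x] norm_le_lyap[of t "blinfun_apply (U t s) x"] s by linarith
    also have "\<dots> \<le> 2 * C * exp (- \<nu> * (t - s)) * (M s * norm x)"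
      using C by (intro mult_left_mono lyap_le_norm s) auto
    finally show "norm (blinfun_apply (U t s) x) \<le> 2 * C * M s * exp (- \<nu> * (t - s)) * norm x"
      by (simp add: mult_ac)
  qed
  then have "exponent_bound U (- \<nu>) (\<lambda>s. (2 * C) * M s)"
    unfolding exponent_bound_def using C M_pos M_continuous by (auto intro!: continuous_intros)
  with \<nu> C show ?thesis by (intro that[of \<nu> "2 * C"]) auto
qed

end


section \<open>Passing to an equivalent norm\<close>

lemma generator_limit_equivalent_norm:
  assumes lim: "generator_limit E N T x y"
    and le: "\<And>u. u \<in> E \<Longrightarrow> 0 \<le> N' u \<and> N' u \<le> a * N u"
    and closed: "\<And>h y. 0 < h \<Longrightarrow> y \<in> E \<Longrightarrow> (\<lambda>s. (T h x s - x s) /\<^sub>R h - y s) \<in> E"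
  shows "generator_limit E N' T x y"
proof -
  from lim have y: "y \<in> E" and N: "((\<lambda>h. N (\<lambda>s. (T h x s - x s) /\<^sub>R h - y s)) \<longlongrightarrow> 0) (at_right 0)"
    by (auto simp: generator_limit_def)
  have "((\<lambda>h. N' (\<lambda>s. (T h x s - x s) /\<^sub>R h - y s)) \<longlongrightarrow> 0) (at_right 0)"
  proof (rule Lim_null_comparison)
    show "((\<lambda>h. a * N (\<lambda>s. (T h x s - x s) /\<^sub>R h - y s)) \<longlongrightarrow> 0) (at_right 0)"
      using tendsto_mult_left[OF N, of a] by simp
    show "\<forall>\<^sub>F h in at_right 0. norm (N' (\<lambda>s. (T h x s - x s) /\<^sub>R h - y s)) \<le> a * N (\<lambda>s. (T h x s - x s) /\<^sub>R h - y s)"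
      using eventually_at_right_less[of 0]
    proof eventually_elim
      case (elim h)
      then show ?case using le[OF closed[OF elim y]] by simp
    qed
  qed
  with y show ?thesis by (simp add: generator_limit_def)
qed

lemma invertible_operator_equivalent_norm:
  assumes inv: "invertible_operator E N D G" and D: "D \<subseteq> E" and a: "0 \<le> a"
    and N': "\<And>u. u \<in> E \<Longrightarrow> N' u \<le> a * N u" and N: "\<And>u. u \<in> E \<Longrightarrow> 0 \<le> N u \<and> N u \<le> b * N' u"
  shows "invertible_operator E N' D G"
proof -
  from inv obtain K where bij: "bij_betw G D E" and K: "\<And>y. y \<in> E \<Longrightarrow> N (inv_into D G y) \<le> K * N y"
    by (auto simp: invertible_operator_def)
  have "N' (inv_into D G y) \<le> (a * \<bar>K\<bar> * b) * N' y" if y: "y \<in> E" for y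
  proof -
    have "inv_into D G y \<in> E"
      using bij y D inv_into_into[of y G D] by (auto simp: bij_betw_def)
    then have "N' (inv_into D G y) \<le> a * N (inv_into D G y)" by (rule N')
    also have "\<dots> \<le> a * (\<bar>K\<bar> * N y)"
      using order_trans[OF K[OF y] mult_right_mono[OF abs_ge_self]] N[OF y] a
      by (intro mult_left_mono) auto
    also have "\<dots> \<le> a * (\<bar>K\<bar> * (b * N' y))"
      using N[OF y] a by (intro mult_left_mono) auto
    finally show ?thesis by (simp add: mult_ac)
  qed
  with bij show ?thesis unfolding invertible_operator_def by blast
qed

lemma invertible_operator_cong:
  assumes "\<And>x. x \<in> D \<Longrightarrow> G x = G' x"
  shows "invertible_operator E N D G \<longleftrightarrow> invertible_operator E N D G'"
proof -
  have "bij_betw G D E \<longleftrightarrow> bij_betw G' D E" by (rule bij_betw_cong) (rule assms)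
  moreover have "inv_into D G = inv_into D G'"
  proof
    fix y show "inv_into D G y = inv_into D G' y"
      unfolding inv_into_def by (rule arg_cong[where f = Eps]) (use assms in auto)
  qed
  ultimately show ?thesis by (simp add: invertible_operator_def)
qed

context bounded_evolution
begin

context
  fixes B :: real
  assumes M_le: "\<And>s. 0 \<le> s \<Longrightarrow> M s \<le> B"
begin

lemma lyap_le_uniform: "0 \<le> t \<Longrightarrow> lyap t x \<le> B * norm x"
  using lyap_le_norm[of t x] mult_right_mono[OF M_le, of t "norm x"] by simp

text \<open>
  A bounded \<open>M\<close> makes \<open>lyap t\<close> equivalent to the norm uniformly in \<open>t\<close>, so that decay at infinity means
  the same in both.
\<close>

lemma adm_space_eq_C00: "adm_space U \<alpha> = C00_space"
proof -
  have "((\<lambda>t. lyap t (u t)) \<longlongrightarrow> 0) at_top \<longleftrightarrow> (u \<longlongrightarrow> 0) at_top" for u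
  proof
    assume l: "((\<lambda>t. lyap t (u t)) \<longlongrightarrow> 0) at_top"
    show "(u \<longlongrightarrow> 0) at_top"
      by (rule Lim_null_comparison[OF _ l])
        (use eventually_ge_at_top[of 0] in eventually_elim, rule norm_le_lyap)
  next
    assume "(u \<longlongrightarrow> 0) at_top"
    then have l: "((\<lambda>t. B * norm (u t)) \<longlongrightarrow> 0) at_top"
      using tendsto_mult_left[OF tendsto_norm_zero, of u at_top B] by simp
    show "((\<lambda>t. lyap t (u t)) \<longlongrightarrow> 0) at_top"
      by (rule lyap_tendsto_le[OF l])
        (use eventually_ge_at_top[of 0] in eventually_elim, rule lyap_le_uniform)
  qed
  then show ?thesis by (auto simp: adm_space_def C00_space_def adm_phi_lyap)
qed

lemma C00_norm_equivalent:
  assumes u: "u \<in> C00_space"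
  shows "0 \<le> C00_norm u" "C00_norm u \<le> adm_norm U \<alpha> u" "adm_norm U \<alpha> u \<le> B * C00_norm u"
proof -
  have uE: "u \<in> adm_space U \<alpha>" using u by (simp add: adm_space_eq_C00)
  have le: "norm (u t) \<le> adm_norm U \<alpha> u" if "0 \<le> t" for t
    using norm_le_lyap[OF that, of "u t"] lyap_le_adm_norm[OF uE that] by linarith
  have bdd: "norm (u t) \<le> C00_norm u" if "0 \<le> t" for t
    unfolding C00_norm_def using that le
    by (intro cSUP_upper bdd_aboveI2[where M = "adm_norm U \<alpha> u"]) auto
  show "0 \<le> C00_norm u" using bdd[of 0] norm_ge_zero[of "u 0"] by linarith
  show "C00_norm u \<le> adm_norm U \<alpha> u" unfolding C00_norm_def using le by (intro cSUP_least) auto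
  show "adm_norm U \<alpha> u \<le> B * C00_norm u"
  proof (rule adm_norm_least)
    fix t :: real assume t: "0 \<le> t"
    have "0 \<le> B" using M_pos[of 0] M_le[of 0] by simp
    then show "lyap t (u t) \<le> B * C00_norm u"
      using lyap_le_uniform[OF t, of "u t"] mult_left_mono[OF bdd[OF t]] by fastforce
  qed
qed

text \<open>
  Functions in \<open>C00_space\<close> vanish at zero, so the two semigroups agree on them; with equivalent norms,
  the generators have the same domain and values, and boundedness of the inverse is the same condition.
\<close>

theorem invertible_C00_iff:
  "invertible_operator C00_space C00_norm (evolution_generator_domain U) (evolution_generator U) \<longleftrightarrow>
   invertible_operator (adm_space U \<alpha>) (adm_norm U \<alpha>) (adm_generator_domain U \<alpha>) (adm_generator U \<alpha>)"
proof -
  let ?E = "C00_space :: (real \<Rightarrow> 'a) set"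
  note E = adm_space_eq_C00
  have B: "0 \<le> B" using M_pos[of 0] M_le[of 0] by simp
  have sg: "evolution_semigroup U h u = adm_semigroup U h u" if "u \<in> ?E" for u h
    using that by (auto simp: evolution_semigroup_def adm_semigroup_def C00_space_def)
  have closed: "(\<lambda>s. (adm_semigroup U h u s - u s) /\<^sub>R h - y s) \<in> ?E" if "u \<in> ?E" "y \<in> ?E" "0 < h" for u y h
    using difference_quotient_closed[of u y h] that by (simp add: E)
  have lim: "generator_limit ?E C00_norm (evolution_semigroup U) u y \<longleftrightarrow>
             generator_limit ?E (adm_norm U \<alpha>) (adm_semigroup U) u y" if u: "u \<in> ?E" for u y
  proof -
    have "generator_limit ?E C00_norm (evolution_semigroup U) u y \<longleftrightarrow>
          generator_limit ?E C00_norm (adm_semigroup U) u y"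
      by (simp add: generator_limit_def sg[OF u])
    also have "\<dots> \<longleftrightarrow> generator_limit ?E (adm_norm U \<alpha>) (adm_semigroup U) u y"
    proof
      assume "generator_limit ?E C00_norm (adm_semigroup U) u y"
      then show "generator_limit ?E (adm_norm U \<alpha>) (adm_semigroup U) u y"
        by (rule generator_limit_equivalent_norm[where a = B])
          (use C00_norm_equivalent closed[OF u] in \<open>auto intro: order_trans\<close>)
    next
      assume "generator_limit ?E (adm_norm U \<alpha>) (adm_semigroup U) u y"
      then show "generator_limit ?E C00_norm (adm_semigroup U) u y"
        by (rule generator_limit_equivalent_norm[where a = 1])
          (use C00_norm_equivalent closed[OF u] in auto)
    qed
    finally show ?thesis .
  qed
  have D: "evolution_generator_domain U = adm_generator_domain U \<alpha>"
    by (auto simp: evolution_generator_domain_def adm_generator_domain_def generator_domain_def E lim)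
  have DE: "adm_generator_domain U \<alpha> \<subseteq> ?E"
    by (auto simp: adm_generator_domain_def generator_domain_def E)
  have G: "evolution_generator U u = adm_generator U \<alpha> u" if "u \<in> adm_generator_domain U \<alpha>" for u
    using that DE by (auto simp: evolution_generator_def adm_generator_def generator_def E lim subset_iff)
  have "invertible_operator ?E C00_norm (evolution_generator_domain U) (evolution_generator U) \<longleftrightarrow>
        invertible_operator ?E C00_norm (adm_generator_domain U \<alpha>) (adm_generator U \<alpha>)"
    unfolding D by (rule invertible_operator_cong) (rule G)
  also have "\<dots> \<longleftrightarrow> invertible_operator ?E (adm_norm U \<alpha>) (adm_generator_domain U \<alpha>) (adm_generator U \<alpha>)"
  proof
    assume "invertible_operator ?E C00_norm (adm_generator_domain U \<alpha>) (adm_generator U \<alpha>)"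
    then show "invertible_operator ?E (adm_norm U \<alpha>) (adm_generator_domain U \<alpha>) (adm_generator U \<alpha>)"
      by (rule invertible_operator_equivalent_norm[where a = B and b = 1])
        (use B DE C00_norm_equivalent in auto)
  next
    assume "invertible_operator ?E (adm_norm U \<alpha>) (adm_generator_domain U \<alpha>) (adm_generator U \<alpha>)"
    then show "invertible_operator ?E C00_norm (adm_generator_domain U \<alpha>) (adm_generator U \<alpha>)"
      by (rule invertible_operator_equivalent_norm[where a = 1 and b = B])
        (use DE C00_norm_equivalent in \<open>auto intro: order_trans\<close>)
  qed
  finally show ?thesis by (simp add: E)
qed

end

end


section \<open>The characterization of exponential stability\<close>

theorem theorem3p1:
  fixes U :: "real \<Rightarrow> real \<Rightarrow> 'a::banach \<Rightarrow>\<^sub>L 'a"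
  assumes "evolution_family U"
    and "nonuniform_exp_bounded U"
  shows "(nonuniform_exp_stable U \<longleftrightarrow>
           (\<exists>\<alpha>\<in>admissible_exponents U.
              invertible_operator (adm_space U \<alpha>) (adm_norm U \<alpha>)
                (adm_generator_domain U \<alpha>) (adm_generator U \<alpha>))) \<and>
         (uniform_exp_bounded U \<longrightarrow>
           (uniform_exp_stable U \<longleftrightarrow>
              invertible_operator C00_space C00_norm
                (evolution_generator_domain U) (evolution_generator U)))"
proof (intro conjI impI)
  have loc: "bounded_evolution U \<alpha> M" if "exponent_bound U \<alpha> M" for \<alpha> M
    using assms(1) that by (rule bounded_evolution.intro)
  have strict: "\<exists>M B. exponent_bound U \<alpha> M \<and> (\<forall>s\<ge>0. M s \<le> B)" if "\<alpha> \<in> strict_exponents U" for \<alpha>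
  proof -
    from that obtain M B where "exponent_bound U \<alpha> M" and B: "\<forall>s\<in>M ` {0..}. norm s \<le> B"
      unfolding strict_exponents_def bounded_iff by blast
    moreover have "M s \<le> B" if "0 \<le> s" for s
      using B that by (intro order_trans[OF abs_ge_self[of "M s"]]) auto
    ultimately show ?thesis by blast
  qed
  show "nonuniform_exp_stable U \<longleftrightarrow>
           (\<exists>\<alpha>\<in>admissible_exponents U.
              invertible_operator (adm_space U \<alpha>) (adm_norm U \<alpha>)
                (adm_generator_domain U \<alpha>) (adm_generator U \<alpha>))"
  proof
    assume "nonuniform_exp_stable U"
    then obtain \<alpha> M where "\<alpha> < 0" and b: "exponent_bound U \<alpha> M"
      by (auto simp: nonuniform_exp_stable_def admissible_exponents_def)
    with bounded_evolution.negative_exponent_invertible[OF loc[OF b]]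
    show "\<exists>\<alpha>\<in>admissible_exponents U. invertible_operator (adm_space U \<alpha>) (adm_norm U \<alpha>)
                (adm_generator_domain U \<alpha>) (adm_generator U \<alpha>)"
      by (auto simp: admissible_exponents_def)
  next
    assume "\<exists>\<alpha>\<in>admissible_exponents U. invertible_operator (adm_space U \<alpha>) (adm_norm U \<alpha>)
                (adm_generator_domain U \<alpha>) (adm_generator U \<alpha>)"
    then obtain \<alpha> M where b: "exponent_bound U \<alpha> M"
      and inv: "invertible_operator (adm_space U \<alpha>) (adm_norm U \<alpha>) (adm_generator_domain U \<alpha>) (adm_generator U \<alpha>)"
      by (auto simp: admissible_exponents_def)
    obtain \<nu> C where "0 < \<nu>" "exponent_bound U (- \<nu>) (\<lambda>s. C * M s)"
      using bounded_evolution.invertible_exponential_decay[OF loc[OF b] inv] by metis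
    then show "nonuniform_exp_stable U"
      unfolding nonuniform_exp_stable_def admissible_exponents_def
      by (intro bexI[of _ "- \<nu>"]) auto
  qed
  assume "uniform_exp_bounded U"
  then obtain \<alpha>0 M0 B0 where b0: "exponent_bound U \<alpha>0 M0" and M0: "\<And>s. 0 \<le> s \<Longrightarrow> M0 s \<le> B0"
    using strict by (metis uniform_exp_bounded_def ex_in_conv)
  show "uniform_exp_stable U \<longleftrightarrow>
        invertible_operator C00_space C00_norm (evolution_generator_domain U) (evolution_generator U)"
  proof
    assume "uniform_exp_stable U"
    then obtain \<alpha> M B where "\<alpha> < 0" and b: "exponent_bound U \<alpha> M" and "\<And>s. 0 \<le> s \<Longrightarrow> M s \<le> B"
      using strict by (metis uniform_exp_stable_def)
    then show "invertible_operator C00_space C00_norm (evolution_generator_domain U) (evolution_generator U)"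
      using bounded_evolution.invertible_C00_iff[OF loc[OF b]]
        bounded_evolution.negative_exponent_invertible[OF loc[OF b]] by blast
  next
    assume "invertible_operator C00_space C00_norm (evolution_generator_domain U) (evolution_generator U)"
    then have "invertible_operator (adm_space U \<alpha>0) (adm_norm U \<alpha>0)
        (adm_generator_domain U \<alpha>0) (adm_generator U \<alpha>0)"
      using bounded_evolution.invertible_C00_iff[OF loc[OF b0] M0] by blast
    then obtain \<nu> C where \<nu>: "0 < \<nu>" and C: "0 < C" and b: "exponent_bound U (- \<nu>) (\<lambda>s. C * M0 s)"
      using bounded_evolution.invertible_exponential_decay[OF loc[OF b0]] by metis
    have "bounded ((\<lambda>s. C * M0 s) ` {0..})"
    proof (rule boundedI)
      fix z assume "z \<in> (\<lambda>s. C * M0 s) ` {0..}"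
      then obtain s where s: "0 \<le> s" "z = C * M0 s" by auto
      have "0 < M0 s" using b0 s by (simp add: exponent_bound_def)
      then show "norm z \<le> C * B0" using M0[OF s(1)] C s(2) by (simp add: abs_mult)
    qed
    with b have "- \<nu> \<in> strict_exponents U" by (auto simp: strict_exponents_def)
    with \<nu> show "uniform_exp_stable U"
      unfolding uniform_exp_stable_def by (intro bexI[of _ "- \<nu>"]) auto
  qed
qed

end
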